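(* $$a_2(K[S])=\max_{0\le i\le d-1}\{\deg(\mathbf w_i)\}-2=\max_{0\le i\le d-1}\frac{\omega_1(i)+\omega_2(d-i)}{d}-2.$$
   Context: Let $K$ be a field, $k\ge 3$, and let $0=:a_0<a_1<\cdots<a_k=:d$ be integers with $\gcd(a_1,\dots,a_k)=1$ and $k<d$. Put $A_1=\{0,a_1,\dots,a_k\}$, $A_2=\{d-a_i\mid 0\le i\le k\}$. Let $S\subset\mathbb N^2$ be the additive monoid generated by $(a_i,d-a_i)$, $0\le i\le k$, and $K[S]$ its semigroup ring (isomorphic to $K[s^{a_i}t^{d-a_i}\mid 0\le i\le k]$), graded by $\deg(u_1,u_2)=(u_1+u_2)/d$, with maximal homogeneous ideal $\mathfrak m$. $a_2(K[S])=\sup\{n\mid H^2_{\mathfrak m}(K[S])_n\ne0\}$, where $H^2_{\mathfrak m}$ is local cohomology (not to be confused with the integer $a_2$). For $i\in\{1,2\}$ let $\langle A_i\rangle$ be the submonoid of $\mathbb N$ generated by $A_i$. For $0\le j\le d-1$ let $\omega_i(j)=\min\{\alpha\in\langle A_i\rangle\mid\alpha\equiv j \bmod d\}$, and set $\omega_i(d):=0$. Put $\mathbf w_j=(\omega_1(j),\omega_2(d-j))$ for $0\le j\le d-1$. *)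

theory Defs
  imports
    "HOL-Algebra.Ideal_Product"
    "HOL-Algebra.AbelCoset"
    "HOL-Algebra.Module"
    "HOL-Library.Poly_Mapping"
    "HOL-Library.Product_Plus"
    "HOL-Library.Extended_Real"
    "HOL-Number_Theory.Cong"
begin

section \<open>Graded rings and modules\<close>

text \<open>All gradings are by the integers; the field \<open>ring_comp\<close> resp. \<open>mod_comp\<close>
  gives the homogeneous components.\<close>

record 'r graded_ring = "'r ring" +
  ring_comp :: "int \<Rightarrow> 'r set"

record ('r, 'm) graded_module = "('r, 'm) module" +
  mod_comp :: "int \<Rightarrow> 'm set"

text \<open>\<open>M\<close> is the internal direct sum of the additive subgroups \<open>C n\<close>.\<close>

definition direct_sum_decomposition :: "('m, 'x) ring_scheme \<Rightarrow> (int \<Rightarrow> 'm set) \<Rightarrow> bool" where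
  "direct_sum_decomposition M C \<longleftrightarrow>
     (\<forall>n. subgroup (C n) (add_monoid M)) \<and>
     (\<forall>x \<in> carrier M. \<exists>!c. (\<forall>n. c n \<in> C n) \<and> finite {n. c n \<noteq> \<zero>\<^bsub>M\<^esub>} \<and>
        x = (\<Oplus>\<^bsub>M\<^esub>n \<in> {n. c n \<noteq> \<zero>\<^bsub>M\<^esub>}. c n))"

definition is_graded_module :: "'r graded_ring \<Rightarrow> ('r, 'm) graded_module \<Rightarrow> bool" where
  "is_graded_module R M \<longleftrightarrow>
     Module.module R M \<and> direct_sum_decomposition M (mod_comp M) \<and>
     (\<forall>i j. \<forall>r \<in> ring_comp R i. \<forall>x \<in> mod_comp M j. r \<odot>\<^bsub>M\<^esub> x \<in> mod_comp M (i + j))"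

text \<open>Homomorphisms of graded modules preserve degrees.\<close>

definition graded_hom ::
    "'r graded_ring \<Rightarrow> ('r, 'm) graded_module \<Rightarrow> ('r, 'n) graded_module \<Rightarrow> ('m \<Rightarrow> 'n) set" where
  "graded_hom R M N =
     {h. h \<in> carrier M \<rightarrow> carrier N \<and>
         (\<forall>x \<in> carrier M. \<forall>y \<in> carrier M. h (x \<oplus>\<^bsub>M\<^esub> y) = h x \<oplus>\<^bsub>N\<^esub> h y) \<and>
         (\<forall>r \<in> carrier R. \<forall>x \<in> carrier M. h (r \<odot>\<^bsub>M\<^esub> x) = r \<odot>\<^bsub>N\<^esub> h x) \<and>
         (\<forall>n. h ` mod_comp M n \<subseteq> mod_comp N n)}"

definition regular_module :: "'r graded_ring \<Rightarrow> ('r, 'r) graded_module" where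
  "regular_module R =
     \<lparr>carrier = carrier R, monoid.mult = monoid.mult R, one = one R, zero = zero R, add = add R,
      smult = monoid.mult R, mod_comp = ring_comp R\<rparr>"


section \<open>Local cohomology\<close>

text \<open>
  Injective objects of the category of graded modules. The test modules \<open>M\<close> and \<open>N\<close> range over all
  graded modules whose elements lie in the type \<open>'m\<close> of the elements of \<open>Q\<close>. By the graded form of
  Baer's criterion this is injectivity in the usual sense as soon as \<open>R\<close> embeds into \<open>'m\<close>, which is
  automatic for the terms of a resolution of \<open>R\<close>.
\<close>

definition graded_injective :: "'r graded_ring \<Rightarrow> ('r, 'm) graded_module \<Rightarrow> bool" where
  "graded_injective R Q \<longleftrightarrow>
     is_graded_module R Q \<and>
     (\<forall>(M :: ('r, 'm) graded_module) (N :: ('r, 'm) graded_module) h f.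
        is_graded_module R M \<longrightarrow> is_graded_module R N \<longrightarrow>
        h \<in> graded_hom R M N \<longrightarrow> inj_on h (carrier M) \<longrightarrow> f \<in> graded_hom R M Q \<longrightarrow>
        (\<exists>g \<in> graded_hom R N Q. \<forall>x \<in> carrier M. g (h x) = f x))"

text \<open>\<open>0 \<rightarrow> M \<rightarrow> I 0 \<rightarrow> I 1 \<rightarrow> I 2 \<rightarrow> \<dots>\<close>, with first map \<open>\<epsilon>\<close> and \<open>\<delta> j\<close> from \<open>I j\<close> to \<open>I (j + 1)\<close>.\<close>

definition graded_injective_resolution ::
    "'r graded_ring \<Rightarrow> ('r, 'n) graded_module \<Rightarrow> ('n \<Rightarrow> 'm) \<Rightarrow>
     (nat \<Rightarrow> ('r, 'm) graded_module) \<Rightarrow> (nat \<Rightarrow> 'm \<Rightarrow> 'm) \<Rightarrow> bool" where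
  "graded_injective_resolution R M \<epsilon> I \<delta> \<longleftrightarrow>
     is_graded_module R M \<and>
     (\<forall>j. graded_injective R (I j)) \<and>
     \<epsilon> \<in> graded_hom R M (I 0) \<and>
     (\<forall>j. \<delta> j \<in> graded_hom R (I j) (I (Suc j))) \<and>
     inj_on \<epsilon> (carrier M) \<and>
     \<epsilon> ` carrier M = {x \<in> carrier (I 0). \<delta> 0 x = \<zero>\<^bsub>I 1\<^esub>} \<and>
     (\<forall>j. \<delta> j ` carrier (I j) = {x \<in> carrier (I (Suc j)). \<delta> (Suc j) x = \<zero>\<^bsub>I (Suc (Suc j))\<^esub>})"

text \<open>The functor \<open>\<Gamma>\<^sub>J\<close>; the powers of \<open>J\<close> are taken in the monoid of ideals of \<open>R\<close>.\<close>

definition torsion :: "'r graded_ring \<Rightarrow> 'r set \<Rightarrow> ('r, 'm) graded_module \<Rightarrow> 'm set" where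
  "torsion R J M =
     {x \<in> carrier M. \<exists>n::nat. \<forall>r \<in> J [^]\<^bsub>ideals_set R\<^esub> n. r \<odot>\<^bsub>M\<^esub> x = \<zero>\<^bsub>M\<^esub>}"

definition cocycles ::
    "'r graded_ring \<Rightarrow> 'r set \<Rightarrow> (nat \<Rightarrow> ('r, 'm) graded_module) \<Rightarrow> (nat \<Rightarrow> 'm \<Rightarrow> 'm) \<Rightarrow>
     nat \<Rightarrow> 'm set" where
  "cocycles R J I \<delta> i = {x \<in> torsion R J (I i). \<delta> i x = \<zero>\<^bsub>I (Suc i)\<^esub>}"

definition coboundaries ::
    "'r graded_ring \<Rightarrow> 'r set \<Rightarrow> (nat \<Rightarrow> ('r, 'm) graded_module) \<Rightarrow> (nat \<Rightarrow> 'm \<Rightarrow> 'm) \<Rightarrow>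
     nat \<Rightarrow> 'm set" where
  "coboundaries R J I \<delta> i =
     (case i of 0 \<Rightarrow> {\<zero>\<^bsub>I 0\<^esub>} | Suc j \<Rightarrow> \<delta> j ` torsion R J (I j))"

text \<open>
  The right derived functors of \<open>\<Gamma>\<^sub>J\<close>: cohomology of \<open>\<Gamma>\<^sub>J\<close> applied to an injective resolution
  \<open>(I, \<delta>)\<close> in the category of graded modules, which also supplies the grading.
\<close>

definition local_cohomology ::
    "'r graded_ring \<Rightarrow> 'r set \<Rightarrow> (nat \<Rightarrow> ('r, 'm) graded_module) \<Rightarrow> (nat \<Rightarrow> 'm \<Rightarrow> 'm) \<Rightarrow>
     nat \<Rightarrow> 'm set monoid" where
  "local_cohomology R J I \<delta> i =
     (I i)\<lparr>carrier := cocycles R J I \<delta> i\<rparr> A_Mod coboundaries R J I \<delta> i"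

definition local_cohomology_comp ::
    "'r graded_ring \<Rightarrow> 'r set \<Rightarrow> (nat \<Rightarrow> ('r, 'm) graded_module) \<Rightarrow> (nat \<Rightarrow> 'm \<Rightarrow> 'm) \<Rightarrow>
     nat \<Rightarrow> int \<Rightarrow> 'm set set" where
  "local_cohomology_comp R J I \<delta> i n =
     (\<lambda>z. coboundaries R J I \<delta> i +>\<^bsub>I i\<^esub> z) ` (cocycles R J I \<delta> i \<inter> mod_comp (I i) n)"

text \<open>Supremum in the extended reals, so that it is \<open>-\<infinity>\<close> if the cohomology vanishes.\<close>

definition a_invariant ::
    "'r graded_ring \<Rightarrow> 'r set \<Rightarrow> (nat \<Rightarrow> ('r, 'm) graded_module) \<Rightarrow> (nat \<Rightarrow> 'm \<Rightarrow> 'm) \<Rightarrow>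
     nat \<Rightarrow> ereal" where
  "a_invariant R J I \<delta> i =
     Sup {ereal (of_int n) | n.
       local_cohomology_comp R J I \<delta> i n \<noteq> {\<one>\<^bsub>local_cohomology R J I \<delta> i\<^esub>}}"


section \<open>Monoids and semigroup rings\<close>

inductive_set submonoid_generated :: "'a::comm_monoid_add set \<Rightarrow> 'a set" for A where
  zero: "0 \<in> submonoid_generated A"
| add: "x \<in> A \<Longrightarrow> y \<in> submonoid_generated A \<Longrightarrow> x + y \<in> submonoid_generated A"

text \<open>
  \<open>'a \<Rightarrow>\<^sub>0 'k\<close> is the monoid algebra of \<open>'a\<close>; the algebra of a submonoid \<open>S\<close> consists of the elements
  supported in \<open>S\<close>.
\<close>

definition semigroup_ring ::
    "('a::comm_monoid_add \<Rightarrow> real) \<Rightarrow> 'a set \<Rightarrow> ('a \<Rightarrow>\<^sub>0 'k::field) graded_ring" where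
  "semigroup_ring deg S =
     \<lparr>carrier = {f. Poly_Mapping.keys f \<subseteq> S}, monoid.mult = (*), one = 1, zero = 0, add = (+),
      ring_comp = (\<lambda>n. {f. Poly_Mapping.keys f \<subseteq> S \<and>
                           (\<forall>u \<in> Poly_Mapping.keys f. deg u = of_int n)})\<rparr>"

definition semigroup_ring_max_ideal :: "'a::comm_monoid_add set \<Rightarrow> ('a \<Rightarrow>\<^sub>0 'k::field) set" where
  "semigroup_ring_max_ideal S = {f. Poly_Mapping.keys f \<subseteq> S - {0}}"


section \<open>Projective monomial curves\<close>

definition curve_monoid :: "(nat \<Rightarrow> nat) \<Rightarrow> nat \<Rightarrow> (nat \<times> nat) set" where
  "curve_monoid a k = submonoid_generated {(a i, a k - a i) | i. i \<le> k}"

definition curve_deg :: "nat \<Rightarrow> nat \<times> nat \<Rightarrow> real" where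
  "curve_deg d u = real (fst u + snd u) / real d"

definition A1 :: "(nat \<Rightarrow> nat) \<Rightarrow> nat \<Rightarrow> nat set" where
  "A1 a k = {a i | i. i \<le> k}"

definition A2 :: "(nat \<Rightarrow> nat) \<Rightarrow> nat \<Rightarrow> nat set" where
  "A2 a k = {a k - a i | i. i \<le> k}"

definition apery :: "nat set \<Rightarrow> nat \<Rightarrow> nat \<Rightarrow> nat" where
  "apery A d j =
     (if j = d then 0 else (LEAST \<alpha>. \<alpha> \<in> submonoid_generated A \<and> [\<alpha> = j] (mod d)))"

definition apery_pair :: "(nat \<Rightarrow> nat) \<Rightarrow> nat \<Rightarrow> nat \<Rightarrow> nat \<times> nat" where
  "apery_pair a k j = (apery (A1 a k) (a k) j, apery (A2 a k) (a k) (a k - j))"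

end

theory Submission
  imports Defs
begin

text \<open>
  Let \<open>x, y\<close> be the monomials \<open>(0, d)\<close> and \<open>(d, 0)\<close>; torsion for the maximal ideal is torsion for \<open>x\<close> and
  \<open>y\<close>. Writing \<open>c\<close> for an exponent with \<open>x\<^sup>c s, y\<^sup>c s \<in> S\<close> for all \<open>s\<close> whose coordinates lie in the two
  projections of \<open>S\<close>, every relation \<open>x\<^sup>p\<^sup>+\<^sup>c r = y\<^sup>p\<^sup>+\<^sup>c s\<close> becomes a multiple of the Koszul relation
  after multiplication by \<open>x\<^sup>c\<close> and \<open>y\<^sup>c\<close>. By injectivity, two homogeneous elements \<open>v\<^sub>x, v\<^sub>y\<close> of a graded
  injective module with \<open>y\<^sup>p v\<^sub>x = x\<^sup>p v\<^sub>y\<close> then have, up to such a factor, a common quotient.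
  A diagram chase in the given resolution thus identifies the second local cohomology with the cokernel of
  \<open>R\<^sub>x \<oplus> R\<^sub>y \<rightarrow> R\<^sub>x\<^sub>y\<close>. A monomial \<open>(u, v)\<close> survives there iff \<open>u \<notin> \<langle>A\<^sub>1\<rangle>\<close> and \<open>v \<notin> \<langle>A\<^sub>2\<rangle>\<close>, that is,
  \<open>u \<le> \<omega>\<^sub>1(j) - d\<close> and \<open>v \<le> \<omega>\<^sub>2(d - j) - d\<close> for the residue \<open>j\<close> of \<open>u\<close>; the largest degree is
  the asserted maximum.
\<close>

section \<open>Polynomial mappings and monomials\<close>

lemma sum_single_lookup: "(\<Sum>u\<in>Poly_Mapping.keys f. Poly_Mapping.single u (Poly_Mapping.lookup f u)) = f"
  by (rule poly_mapping_eqI) (simp add: lookup_sum lookup_single when_def in_keys_iff)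

lemma lookup_single_times:
  fixes p :: "'a::cancel_comm_monoid_add" and f :: "'a \<Rightarrow>\<^sub>0 'k::comm_semiring_1"
  shows "Poly_Mapping.lookup (Poly_Mapping.single p 1 * f) (p + u) = Poly_Mapping.lookup f u"
proof -
  have "Poly_Mapping.single p 1 * f = Poly_Mapping.single p 1 *
      (\<Sum>v\<in>Poly_Mapping.keys f. Poly_Mapping.single v (Poly_Mapping.lookup f v))"
    by (simp only: sum_single_lookup)
  also have "\<dots> = (\<Sum>v\<in>Poly_Mapping.keys f. Poly_Mapping.single (p + v) (Poly_Mapping.lookup f v))"
    by (simp add: sum_distrib_left mult_single)
  finally have "Poly_Mapping.single p 1 * f = \<dots>" .
  then show ?thesis
    by (simp add: lookup_sum lookup_single when_def in_keys_iff)
qed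

lemma keys_single_times:
  fixes p :: "'a::cancel_comm_monoid_add" and f :: "'a \<Rightarrow>\<^sub>0 'k::comm_semiring_1"
  shows "Poly_Mapping.keys (Poly_Mapping.single p 1 * f) = (+) p ` Poly_Mapping.keys f"
proof
  show "Poly_Mapping.keys (Poly_Mapping.single p 1 * f) \<subseteq> (+) p ` Poly_Mapping.keys f"
    using keys_mult[of "Poly_Mapping.single p 1" f] by (auto split: if_splits)
qed (auto simp: in_keys_iff lookup_single_times)

lemma single_times_cancel:
  fixes p :: "'a::cancel_comm_monoid_add" and f g :: "'a \<Rightarrow>\<^sub>0 'k::comm_semiring_1"
  assumes "Poly_Mapping.single p 1 * f = Poly_Mapping.single p 1 * g"
  shows "f = g"
  by (rule poly_mapping_eqI) (metis assms lookup_single_times)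

lemma single_times_exists:
  fixes p :: "'a::cancel_comm_monoid_add" and f :: "'a \<Rightarrow>\<^sub>0 'k::comm_semiring_1"
  assumes "Poly_Mapping.keys f \<subseteq> (+) p ` S"
  obtains g where "Poly_Mapping.keys g \<subseteq> S" "f = Poly_Mapping.single p 1 * g"
proof -
  obtain \<phi> where \<phi>: "\<phi> u \<in> S" "p + \<phi> u = u" if "u \<in> Poly_Mapping.keys f" for u
  proof -
    have "\<forall>u\<in>Poly_Mapping.keys f. \<exists>v. v \<in> S \<and> p + v = u"
      using assms by blast
    then show thesis using that by (auto simp: bchoice_iff)
  qed
  define g where "g = (\<Sum>u\<in>Poly_Mapping.keys f. Poly_Mapping.single (\<phi> u) (Poly_Mapping.lookup f u))"
  have "Poly_Mapping.keys g \<subseteq> (\<Union>u\<in>Poly_Mapping.keys f. {\<phi> u})"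
    unfolding g_def by (rule order.trans[OF keys_sum]) (auto split: if_splits)
  moreover have "Poly_Mapping.single p 1 * g = f"
    unfolding g_def using \<phi>(2) by (simp add: sum_distrib_left mult_single sum_single_lookup cong: sum.cong)
  ultimately show thesis using \<phi>(1) that[of g] by auto
qed

text \<open>The terms of \<open>f\<close> with exponent in \<open>p\<close> + \<open>S\<close> are
  divided by the monomial \<open>p\<close>, all others by the monomial \<open>q\<close>. The two
  groups have disjoint supports, so the shifted supports of \<open>g\<close> and \<open>h\<close>
  stay inside that of \<open>f\<close>. This keeps the quotients homogeneous whenever
  \<open>f\<close> is.\<close>

lemma two_singles_times_exist:
  fixes p q :: "'a::cancel_comm_monoid_add" and f :: "'a \<Rightarrow>\<^sub>0 'k::comm_semiring_1"
  assumes "Poly_Mapping.keys f \<subseteq> (+) p ` S \<union> (+) q ` S"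
  obtains g h where "Poly_Mapping.keys g \<subseteq> S" "Poly_Mapping.keys h \<subseteq> S"
    "(+) p ` Poly_Mapping.keys g \<subseteq> Poly_Mapping.keys f" "(+) q ` Poly_Mapping.keys h \<subseteq> Poly_Mapping.keys f"
    "f = Poly_Mapping.single p 1 * g + Poly_Mapping.single q 1 * h"
proof -
  define part where "part A = (\<Sum>u\<in>Poly_Mapping.keys f \<inter> A. Poly_Mapping.single u (Poly_Mapping.lookup f u))" for A
  have keys_part: "Poly_Mapping.keys (part A) \<subseteq> Poly_Mapping.keys f \<inter> A" for A
    unfolding part_def by (rule order.trans[OF keys_sum]) (auto split: if_splits)
  let ?P = "(+) p ` S"
  have f: "f = part ?P + part (- ?P)"
  proof -
    have "(\<Sum>u\<in>Poly_Mapping.keys f. Poly_Mapping.single u (Poly_Mapping.lookup f u)) = part ?P + part (- ?P)"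
      unfolding part_def Diff_eq[symmetric] by (rule sum.Int_Diff) simp
    then show ?thesis by (simp only: sum_single_lookup)
  qed
  have P: "Poly_Mapping.keys (part ?P) \<subseteq> (+) p ` S" and Q: "Poly_Mapping.keys (part (- ?P)) \<subseteq> (+) q ` S"
    using keys_part[of ?P] keys_part[of "- ?P"] assms by blast+
  obtain g where g: "Poly_Mapping.keys g \<subseteq> S" "part ?P = Poly_Mapping.single p 1 * g"
    by (rule single_times_exists[OF P])
  obtain h where h: "Poly_Mapping.keys h \<subseteq> S" "part (- ?P) = Poly_Mapping.single q 1 * h"
    by (rule single_times_exists[OF Q])
  show thesis
  proof (rule that[OF g(1) h(1)])
    show "(+) p ` Poly_Mapping.keys g \<subseteq> Poly_Mapping.keys f"
      using keys_part[of ?P] by (simp add: g(2) keys_single_times)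
    show "(+) q ` Poly_Mapping.keys h \<subseteq> Poly_Mapping.keys f"
      using keys_part[of "- ?P"] by (simp add: h(2) keys_single_times)
  qed (use f in \<open>simp only: g(2) h(2)\<close>)
qed

section \<open>Graded modules\<close>

lemma direct_sum_unique:
  assumes "direct_sum_decomposition M C" "x \<in> carrier M"
    and "\<And>n. c n \<in> C n" "finite {n. c n \<noteq> \<zero>\<^bsub>M\<^esub>}" "x = (\<Oplus>\<^bsub>M\<^esub>n \<in> {n. c n \<noteq> \<zero>\<^bsub>M\<^esub>}. c n)"
    and "\<And>n. c' n \<in> C n" "finite {n. c' n \<noteq> \<zero>\<^bsub>M\<^esub>}" "x = (\<Oplus>\<^bsub>M\<^esub>n \<in> {n. c' n \<noteq> \<zero>\<^bsub>M\<^esub>}. c' n)"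
  shows "c = c'"
  using assms unfolding direct_sum_decomposition_def by blast

lemma is_graded_moduleD:
  assumes "is_graded_module R M"
  shows "Module.module R M" "direct_sum_decomposition M (mod_comp M)"
    "\<And>n. subgroup (mod_comp M n) (add_monoid M)"
    "\<And>r x i j. r \<in> ring_comp R i \<Longrightarrow> x \<in> mod_comp M j \<Longrightarrow> r \<odot>\<^bsub>M\<^esub> x \<in> mod_comp M (i + j)"
  using assms by (auto simp: is_graded_module_def direct_sum_decomposition_def)

lemma is_graded_module_comp:
  assumes "is_graded_module R M"
  shows "x \<in> mod_comp M n \<Longrightarrow> x \<in> carrier M" "\<zero>\<^bsub>M\<^esub> \<in> mod_comp M n"
    "x \<in> mod_comp M n \<Longrightarrow> y \<in> mod_comp M n \<Longrightarrow> x \<oplus>\<^bsub>M\<^esub> y \<in> mod_comp M n"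
proof -
  interpret subgroup "mod_comp M n" "add_monoid M" using is_graded_moduleD(3)[OF assms] .
  show "x \<in> mod_comp M n \<Longrightarrow> x \<in> carrier M" "\<zero>\<^bsub>M\<^esub> \<in> mod_comp M n"
    "x \<in> mod_comp M n \<Longrightarrow> y \<in> mod_comp M n \<Longrightarrow> x \<oplus>\<^bsub>M\<^esub> y \<in> mod_comp M n"
    using subset one_closed m_closed by auto
qed

lemma graded_homD:
  assumes "h \<in> graded_hom R M N"
  shows "x \<in> carrier M \<Longrightarrow> h x \<in> carrier N"
    "x \<in> carrier M \<Longrightarrow> y \<in> carrier M \<Longrightarrow> h (x \<oplus>\<^bsub>M\<^esub> y) = h x \<oplus>\<^bsub>N\<^esub> h y"
    "r \<in> carrier R \<Longrightarrow> x \<in> carrier M \<Longrightarrow> h (r \<odot>\<^bsub>M\<^esub> x) = r \<odot>\<^bsub>N\<^esub> h x"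
    "x \<in> mod_comp M n \<Longrightarrow> h x \<in> mod_comp N n"
  using assms by (auto simp: graded_hom_def image_subset_iff)

lemma graded_hom_minus:
  assumes "Module.module R M" "Module.module R N" "h \<in> graded_hom R M N"
  shows "h \<zero>\<^bsub>M\<^esub> = \<zero>\<^bsub>N\<^esub>"
    "x \<in> carrier M \<Longrightarrow> y \<in> carrier M \<Longrightarrow> h (x \<ominus>\<^bsub>M\<^esub> y) = h x \<ominus>\<^bsub>N\<^esub> h y"
proof -
  interpret M: Module.module R M by fact
  interpret N: Module.module R N by fact
  interpret abelian_group_hom M N h
    by (intro abelian_group_homI group_hom.intro group_hom_axioms.intro homI
          M.abelian_group_axioms N.abelian_group_axioms M.a_group N.a_group)
      (simp_all add: graded_homD[OF assms(3)])
  show "h \<zero>\<^bsub>M\<^esub> = \<zero>\<^bsub>N\<^esub>" by simp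
  show "h (x \<ominus>\<^bsub>M\<^esub> y) = h x \<ominus>\<^bsub>N\<^esub> h y" if "x \<in> carrier M" "y \<in> carrier M"
    using that by (simp add: M.minus_eq N.minus_eq)
qed

lemma graded_hom_finsum:
  assumes "Module.module R M" "Module.module R N" "h \<in> graded_hom R M N"
    and "finite A" "\<And>i. i \<in> A \<Longrightarrow> c i \<in> carrier M"
  shows "h (\<Oplus>\<^bsub>M\<^esub>i\<in>A. c i) = (\<Oplus>\<^bsub>N\<^esub>i\<in>A. h (c i))"
proof -
  interpret M: Module.module R M by fact
  interpret N: Module.module R N by fact
  show ?thesis using assms(4,5)
  proof (induction A)
    case (insert i A)
    then show ?case
      by (simp add: Pi_iff M.finsum_closed graded_homD(1,2)[OF assms(3)])
  qed (simp add: graded_hom_minus[OF assms(1-3)])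
qed

text \<open>The images of the components of \<open>x\<close>, and the family concentrated in degree
  \<open>n\<close> with value \<open>h x\<close>, both decompose \<open>h x\<close>. By uniqueness
  they agree, so the component of \<open>x\<close> in degree \<open>n\<close> is already a preimage.
  Exactness of a graded complex thereby holds in each degree.\<close>

lemma graded_hom_homogeneous_preimage:
  assumes M: "is_graded_module R M" and N: "is_graded_module R N" and h: "h \<in> graded_hom R M N"
    and x: "x \<in> carrier M" "h x \<in> mod_comp N n"
  obtains y where "y \<in> mod_comp M n" "h y = h x"
proof -
  interpret M: Module.module R M using is_graded_moduleD[OF M] by blast
  interpret N: Module.module R N using is_graded_moduleD[OF N] by blast
  note minus = graded_hom_minus[OF M.module_axioms N.module_axioms h]
  obtain c where c: "\<And>n. c n \<in> mod_comp M n" "finite {n. c n \<noteq> \<zero>\<^bsub>M\<^esub>}"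
    "x = (\<Oplus>\<^bsub>M\<^esub>n \<in> {n. c n \<noteq> \<zero>\<^bsub>M\<^esub>}. c n)"
    using is_graded_moduleD(2)[OF M] x unfolding direct_sum_decomposition_def by blast
  have cM: "c n \<in> carrier M" for n using c(1) is_graded_module_comp[OF M] by blast
  have "(\<lambda>n. h (c n)) = (\<lambda>i. if i = n then h x else \<zero>\<^bsub>N\<^esub>)"
  proof (rule direct_sum_unique[OF is_graded_moduleD(2)[OF N] graded_homD(1)[OF h x(1)]])
    show fin: "finite {n. h (c n) \<noteq> \<zero>\<^bsub>N\<^esub>}"
      by (rule finite_subset[OF _ c(2)]) (auto simp: minus)
    have "h x = (\<Oplus>\<^bsub>N\<^esub>n \<in> {n. c n \<noteq> \<zero>\<^bsub>M\<^esub>}. h (c n))"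
      unfolding c(3) using graded_hom_finsum[OF M.module_axioms N.module_axioms h c(2) cM] by auto
    also have "\<dots> = (\<Oplus>\<^bsub>N\<^esub>n \<in> {n. h (c n) \<noteq> \<zero>\<^bsub>N\<^esub>}. h (c n))"
      by (rule N.add.finprod_mono_neutral_cong_right)
        (use c(2) in \<open>auto simp: minus intro!: graded_homD[OF h] cM\<close>)
    finally show "h x = \<dots>" .
    show "finite {i. (if i = n then h x else \<zero>\<^bsub>N\<^esub>) \<noteq> \<zero>\<^bsub>N\<^esub>}"
      by (rule finite_subset[of _ "{n}"]) auto
    show "h x = (\<Oplus>\<^bsub>N\<^esub>i\<in>{i. (if i = n then h x else \<zero>\<^bsub>N\<^esub>) \<noteq> \<zero>\<^bsub>N\<^esub>}. if i = n then h x else \<zero>\<^bsub>N\<^esub>)"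
    proof (cases "h x = \<zero>\<^bsub>N\<^esub>")
      case False
      then have "{i. (if i = n then h x else \<zero>\<^bsub>N\<^esub>) \<noteq> \<zero>\<^bsub>N\<^esub>} = {n}" by auto
      then show ?thesis using graded_homD(1)[OF h x(1)] by simp
    qed auto
  qed (use c(1) x(2) graded_homD(4)[OF h] is_graded_module_comp(2)[OF N] in auto)
  then have "h (c n) = h x" by metis
  with c(1) that show thesis by blast
qed

section \<open>Extension of homomorphisms from two-generated monomial ideals\<close>

text \<open>The module \<open>K[T]\<close> shifted by \<open>n\<close>, carried along an injection \<open>e\<close> to the type of the terms of
  the resolution; the ring structure fields are junk.\<close>

definition shifted_ideal ::
    "('a::comm_monoid_add \<Rightarrow> real) \<Rightarrow> 'a set \<Rightarrow> (('a \<Rightarrow>\<^sub>0 'k::field) \<Rightarrow> 'm) \<Rightarrow> 'a set \<Rightarrow> int \<Rightarrow>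
      ('a \<Rightarrow>\<^sub>0 'k, 'm) graded_module" where
  "shifted_ideal deg S e T n =
     (let bk = inv_into {f. Poly_Mapping.keys f \<subseteq> S} e in
     \<lparr>carrier = e ` {f. Poly_Mapping.keys f \<subseteq> T}, monoid.mult = (\<lambda>x y. x), one = e 0, zero = e 0,
      add = (\<lambda>x y. e (bk x + bk y)), smult = (\<lambda>r x. e (r * bk x)),
      mod_comp = (\<lambda>i. e ` {f. Poly_Mapping.keys f \<subseteq> T \<and>
        (\<forall>u \<in> Poly_Mapping.keys f. deg u = of_int (i - n))})\<rparr>)"

lemma graded_injectiveD:
  fixes Q M N :: "('r, 'm) graded_module"
  assumes "graded_injective R Q" "is_graded_module R M" "is_graded_module R N"
    "h \<in> graded_hom R M N" "inj_on h (carrier M)" "f \<in> graded_hom R M Q"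
  shows "\<exists>g \<in> graded_hom R N Q. \<forall>x \<in> carrier M. g (h x) = f x"
  using assms(1)[unfolded graded_injective_def, THEN conjunct2, rule_format, OF assms(2-6)] .

locale graded_semigroup_ring =
  fixes S :: "'a::cancel_comm_monoid_add set" and deg :: "'a \<Rightarrow> real"
    and R :: "('a \<Rightarrow>\<^sub>0 'k::field) graded_ring"
  assumes zero_mem: "0 \<in> S" and add_mem: "u \<in> S \<Longrightarrow> v \<in> S \<Longrightarrow> u + v \<in> S"
    and deg_add: "deg (u + v) = deg u + deg v"
    and deg_Ints: "u \<in> S \<Longrightarrow> deg u \<in> \<int>"
    and R_eq: "R = semigroup_ring deg S"
begin

lemma R_simps:
  "carrier R = {f. Poly_Mapping.keys f \<subseteq> S}" "monoid.mult R = (*)" "one R = 1" "zero R = 0" "add R = (+)"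
  "ring_comp R n = {f. Poly_Mapping.keys f \<subseteq> S \<and> (\<forall>u \<in> Poly_Mapping.keys f. deg u = of_int n)}"
  by (simp_all add: R_eq semigroup_ring_def)

lemma keys_times_subset:
  fixes f g :: "'a \<Rightarrow>\<^sub>0 'k"
  assumes "Poly_Mapping.keys f \<subseteq> A" "Poly_Mapping.keys g \<subseteq> B" "\<And>u v. u \<in> A \<Longrightarrow> v \<in> B \<Longrightarrow> u + v \<in> C"
  shows "Poly_Mapping.keys (f * g) \<subseteq> C"
  using keys_mult[of f g] assms by blast

lemma keys_plus_subset:
  fixes f g :: "'a \<Rightarrow>\<^sub>0 'k"
  assumes "Poly_Mapping.keys f \<subseteq> A" "Poly_Mapping.keys g \<subseteq> A"
  shows "Poly_Mapping.keys (f + g) \<subseteq> A"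
  using keys_add[of f g] assms by blast

lemma times_mem: "f \<in> carrier R \<Longrightarrow> g \<in> carrier R \<Longrightarrow> f * g \<in> carrier R"
  using keys_times_subset[of f S g S S] by (auto simp: R_simps add_mem)

lemma plus_mem: "f \<in> carrier R \<Longrightarrow> g \<in> carrier R \<Longrightarrow> f + g \<in> carrier R"
  using keys_plus_subset[of f S g] by (auto simp: R_simps)

lemma uminus_mem: "f \<in> carrier R \<Longrightarrow> - f \<in> carrier R"
  by (auto simp: R_simps)

lemma cring_R: "cring R"
proof (rule cringI)
  show "abelian_group R"
  proof (rule abelian_groupI)
    fix f assume "f \<in> carrier R"
    then show "\<exists>g\<in>carrier R. g \<oplus>\<^bsub>R\<^esub> f = \<zero>\<^bsub>R\<^esub>"
      by (intro bexI[of _ "- f"]) (auto simp: R_simps)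
  next
    fix f g assume "f \<in> carrier R" "g \<in> carrier R"
    then show "f \<oplus>\<^bsub>R\<^esub> g \<in> carrier R" using plus_mem by (simp add: R_simps(5))
  qed (simp_all add: R_simps add_ac)
  show "Group.comm_monoid R"
  proof (rule comm_monoidI)
    fix f g assume "f \<in> carrier R" "g \<in> carrier R"
    then show "f \<otimes>\<^bsub>R\<^esub> g \<in> carrier R" using times_mem by (simp add: R_simps(2))
  qed (simp_all add: R_simps zero_mem mult_ac)
qed (simp add: R_simps distrib_right)

lemma shifted_ideal_simps:
  fixes e :: "('a \<Rightarrow>\<^sub>0 'k) \<Rightarrow> 'm"
  shows "carrier (shifted_ideal deg S e T n) = e ` {f. Poly_Mapping.keys f \<subseteq> T}"
    "zero (shifted_ideal deg S e T n) = e 0"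
    "mod_comp (shifted_ideal deg S e T n) i = e ` {f. Poly_Mapping.keys f \<subseteq> T \<and>
        (\<forall>u \<in> Poly_Mapping.keys f. deg u = of_int (i - n))}"
    "\<And>f g. \<lbrakk>inj_on e {f. Poly_Mapping.keys f \<subseteq> S}; T \<subseteq> S; Poly_Mapping.keys f \<subseteq> T; Poly_Mapping.keys g \<subseteq> T\<rbrakk>
      \<Longrightarrow> e f \<oplus>\<^bsub>shifted_ideal deg S e T n\<^esub> e g = e (f + g)"
    "\<And>r f. \<lbrakk>inj_on e {f. Poly_Mapping.keys f \<subseteq> S}; T \<subseteq> S; Poly_Mapping.keys f \<subseteq> T\<rbrakk>
      \<Longrightarrow> r \<odot>\<^bsub>shifted_ideal deg S e T n\<^esub> e f = e (r * f)"
  by (auto simp: shifted_ideal_def Let_def inv_into_f_f)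

text \<open>\<open>T\<close> absorbs addition of elements of \<open>S\<close>, so the elements
  supported in \<open>T\<close> form an ideal, and injectivity of \<open>e\<close> carries its
  structure over. Sorting the terms of an element by degree gives the decomposition;
  \<open>deg_Ints\<close> places every term in an integral degree.\<close>

lemma graded_shifted_ideal:
  fixes e :: "('a \<Rightarrow>\<^sub>0 'k) \<Rightarrow> 'm"
  assumes inj: "inj_on e {f. Poly_Mapping.keys f \<subseteq> S}" and T: "T \<subseteq> S" "\<And>u v. u \<in> S \<Longrightarrow> v \<in> T \<Longrightarrow> u + v \<in> T"
  shows "is_graded_module R (shifted_ideal deg S e T n)" (is "is_graded_module R ?M")
proof -
  let ?in = "\<lambda>f. Poly_Mapping.keys f \<subseteq> T"
  let ?C = "\<lambda>i. {f. ?in f \<and> (\<forall>u \<in> Poly_Mapping.keys f. deg u = of_int (i - n))}"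
  have eq: "e f = e g \<longleftrightarrow> f = g" if "?in f" "?in g" for f g
    using inj that T(1) by (intro inj_on_eq_iff) auto
  have in_plus: "?in (f + g)" if "?in f" "?in g" for f g :: "'a \<Rightarrow>\<^sub>0 'k"
    using keys_plus_subset that by blast
  have in_times: "?in (r * f)" if "Poly_Mapping.keys r \<subseteq> S" "?in f" for r f :: "'a \<Rightarrow>\<^sub>0 'k"
    using keys_times_subset that T(2) by blast
  note M_simps = shifted_ideal_simps(1-3) and M_add = shifted_ideal_simps(4)[OF inj T(1)]
    and M_smult = shifted_ideal_simps(5)[OF inj T(1)]
  have neg: "e (- f) \<oplus>\<^bsub>?M\<^esub> e f = e 0" if "?in f" for f
    using that M_add[of "- f" f] by simp
  have "abelian_group ?M"
  proof (rule abelian_groupI)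
    fix x assume "x \<in> carrier ?M"
    then obtain f where "?in f" "x = e f" by (auto simp: M_simps)
    then show "\<exists>y\<in>carrier ?M. y \<oplus>\<^bsub>?M\<^esub> x = \<zero>\<^bsub>?M\<^esub>"
      by (intro bexI[of _ "e (- f)"]) (auto simp: M_simps neg)
  qed (auto simp: M_simps M_add in_plus add_ac)
  then interpret M: Module.module R ?M
    by (intro moduleI cring_R)
      (auto simp: R_simps M_simps M_smult M_add in_plus in_times algebra_simps intro!: imageI)
  have inv_M: "\<ominus>\<^bsub>?M\<^esub> e f = e (- f)" if "?in f" for f
    using that by (intro M.minus_equality) (auto simp: M_simps neg)
  have sum: "(\<Oplus>\<^bsub>?M\<^esub>i\<in>A. e (g i)) = e (\<Sum>i\<in>A. g i) \<and> ?in (\<Sum>i\<in>A. g i)"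
    if "finite A" "\<And>i. ?in (g i)" for A and g :: "int \<Rightarrow> 'a \<Rightarrow>\<^sub>0 'k"
    using that
  proof (induction A)
    case empty
    then show ?case by (simp add: M_simps)
  next
    case (insert i A)
    then have "(\<Oplus>\<^bsub>?M\<^esub>i\<in>insert i A. e (g i)) = e (g i) \<oplus>\<^bsub>?M\<^esub> (\<Oplus>\<^bsub>?M\<^esub>i\<in>A. e (g i))"
      by (intro M.finsum_insert) (auto simp: M_simps)
    then show ?case using insert by (simp add: M_add in_plus)
  qed
  \<comment> \<open>The summand in shifted degree \<open>i\<close> collects the terms of original
    degree \<open>i - n\<close>.\<close>
  define part where "part f i = (\<Sum>u\<in>{u \<in> Poly_Mapping.keys f. deg u = of_int (i - n)}.
      Poly_Mapping.single u (Poly_Mapping.lookup f u))" for f :: "'a \<Rightarrow>\<^sub>0 'k" and i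
  have lookup_part: "Poly_Mapping.lookup (part f i) u =
      (if deg u = of_int (i - n) then Poly_Mapping.lookup f u else 0)" for f i u
    by (auto simp: part_def lookup_sum lookup_single when_def in_keys_iff)
  have part_C: "part f i \<in> ?C i" if "?in f" for f i
    using that by (force simp: in_keys_iff lookup_part split: if_splits)
  have sum_part: "finite {i. part f i \<noteq> 0} \<and> (\<Sum>i\<in>{i. part f i \<noteq> 0}. part f i) = f" if f: "?in f" for f
  proof
    \<comment> \<open>A nonzero part comes from some exponent \<open>u\<close>, whose degree
      determines the index as \<open>n\<close> plus the degree of \<open>u\<close>; the floor only
      turns this real number into an integer.\<close>
    have sub: "{i. part f i \<noteq> 0} \<subseteq> (\<lambda>u. n + \<lfloor>deg u\<rfloor>) ` Poly_Mapping.keys f"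
    proof
      fix i assume "i \<in> {i. part f i \<noteq> 0}"
      then obtain u where "u \<in> Poly_Mapping.keys f" "deg u = of_int (i - n)"
        by (auto simp: part_def elim!: sum.not_neutral_contains_not_neutral)
      then show "i \<in> (\<lambda>u. n + \<lfloor>deg u\<rfloor>) ` Poly_Mapping.keys f"
        by (intro image_eqI[of _ _ u]) auto
    qed
    then show fin: "finite {i. part f i \<noteq> 0}"
      by (rule finite_subset) simp
    show "(\<Sum>i\<in>{i. part f i \<noteq> 0}. part f i) = f"
    proof (rule poly_mapping_eqI)
      fix u
      show "Poly_Mapping.lookup (\<Sum>i\<in>{i. part f i \<noteq> 0}. part f i) u = Poly_Mapping.lookup f u"
      proof (cases "u \<in> Poly_Mapping.keys f")
        case True
        then obtain j where j: "deg u = of_int j"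
          using f T(1) deg_Ints by (meson Ints_cases subsetD)
        have "Poly_Mapping.lookup (part f i) u = (if i = j + n then Poly_Mapping.lookup f u else 0)" for i
          by (auto simp: lookup_part j)
        moreover from this[of "j + n"] have "part f (j + n) \<noteq> 0"
          using True by (auto simp: in_keys_iff)
        ultimately show ?thesis by (simp add: lookup_sum fin)
      qed (simp add: lookup_sum lookup_part in_keys_iff cong: if_cong)
    qed
  qed
  \<comment> \<open>The coefficient of the sum at \<open>u\<close> receives a contribution only from
    the index \<open>i\<close> for which \<open>u\<close> has degree \<open>i - n\<close>. Hence the
    sum determines every summand.\<close>
  have part_unique: "g = part (\<Sum>i\<in>A. g i)"
    if A: "finite A" "\<And>i. g i \<in> ?C i" "\<And>i. i \<notin> A \<Longrightarrow> g i = 0" for g A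
  proof
    fix i
    show "g i = part (\<Sum>i\<in>A. g i) i"
    proof (rule poly_mapping_eqI)
      fix u
      have "Poly_Mapping.lookup (g j) u = 0" if "deg u \<noteq> of_int (j - n)" for j
        using that A(2)[of j] by (auto simp: in_keys_iff)
      then have "Poly_Mapping.lookup (\<Sum>i\<in>A. g i) u = (\<Sum>j\<in>A. if j = i then Poly_Mapping.lookup (g i) u else 0)"
        if "deg u = of_int (i - n)"
        using that by (auto simp: lookup_sum intro!: sum.cong)
      then show "Poly_Mapping.lookup (g i) u = Poly_Mapping.lookup (part (\<Sum>i\<in>A. g i) i) u"
        using A(1) A(3)[of i] A(2)[of i] by (auto simp: lookup_part in_keys_iff)
    qed
  qed
  have zero_iff: "{i. e (g i) \<noteq> \<zero>\<^bsub>?M\<^esub>} = {i. g i \<noteq> 0}" if "\<And>i. ?in (g i)" for g :: "int \<Rightarrow> 'a \<Rightarrow>\<^sub>0 'k"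
    using that by (auto simp: M_simps eq)
  have "direct_sum_decomposition ?M (mod_comp ?M)"
    unfolding direct_sum_decomposition_def
  proof (intro conjI allI ballI)
    fix i
    show "subgroup (mod_comp ?M i) (add_monoid ?M)"
    proof (rule M.add.subgroupI)
      fix x assume "x \<in> mod_comp ?M i"
      then obtain f where f: "f \<in> ?C i" "x = e f" by (auto simp: M_simps)
      show "\<ominus>\<^bsub>?M\<^esub> x \<in> mod_comp ?M i"
        using f by (auto simp: inv_M M_simps)
      fix y assume "y \<in> mod_comp ?M i"
      then obtain g where g: "g \<in> ?C i" "y = e g" by (auto simp: M_simps)
      have "f + g \<in> ?C i" using f(1) g(1) keys_add[of f g] by blast
      then show "x \<oplus>\<^bsub>?M\<^esub> y \<in> mod_comp ?M i"
        using f g by (auto simp: M_simps M_add)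
    next
      have "e 0 \<in> mod_comp ?M i" by (auto simp: M_simps intro!: imageI)
      then show "mod_comp ?M i \<noteq> {}" by blast
    qed (auto simp: M_simps)
  next
    fix x assume "x \<in> carrier ?M"
    then obtain f where f: "?in f" "x = e f" by (auto simp: M_simps)
    have inp: "?in (part f i)" for i using part_C[OF f(1)] by blast
    show "\<exists>!c. (\<forall>n. c n \<in> mod_comp ?M n) \<and> finite {n. c n \<noteq> \<zero>\<^bsub>?M\<^esub>} \<and>
        x = (\<Oplus>\<^bsub>?M\<^esub>n \<in> {n. c n \<noteq> \<zero>\<^bsub>?M\<^esub>}. c n)"
    proof (intro ex1I[of _ "\<lambda>i. e (part f i)"] conjI allI)
      show "e (part f i) \<in> mod_comp ?M i" for i
        using part_C[OF f(1)] by (auto simp: M_simps)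
      show "finite {i. e (part f i) \<noteq> \<zero>\<^bsub>?M\<^esub>}"
        using sum_part[OF f(1)] by (simp only: zero_iff[of "part f", OF inp])
      show "x = (\<Oplus>\<^bsub>?M\<^esub>i \<in> {i. e (part f i) \<noteq> \<zero>\<^bsub>?M\<^esub>}. e (part f i))"
        using sum_part[OF f(1)] sum[of _ "part f", OF _ inp] by (simp only: zero_iff[of "part f", OF inp] f(2))
    next
      fix c
      assume c: "(\<forall>n. c n \<in> mod_comp ?M n) \<and> finite {n. c n \<noteq> \<zero>\<^bsub>?M\<^esub>} \<and>
        x = (\<Oplus>\<^bsub>?M\<^esub>n \<in> {n. c n \<noteq> \<zero>\<^bsub>?M\<^esub>}. c n)"
      then have "c i \<in> e ` ?C i" for i unfolding M_simps by blast
      then have "\<forall>i. \<exists>g. g \<in> ?C i \<and> c i = e g" by blast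
      then have "\<exists>g. \<forall>i. g i \<in> ?C i \<and> c i = e (g i)" by (rule choice)
      then obtain g where g: "\<And>i. g i \<in> ?C i" "\<And>i. c i = e (g i)" by blast
      have c_eq: "c = (\<lambda>i. e (g i))" using g(2) by (rule ext)
      have ing: "?in (g i)" for i using g(1) by blast
      have fin: "finite {i. g i \<noteq> 0}" and x: "x = (\<Oplus>\<^bsub>?M\<^esub>i\<in>{i. g i \<noteq> 0}. e (g i))"
        using c unfolding c_eq zero_iff[of g, OF ing] by blast+
      have "e f = e (\<Sum>i\<in>{i. g i \<noteq> 0}. g i)"
        using x sum[of _ g, OF fin ing] f(2) by simp
      then have "f = (\<Sum>i\<in>{i. g i \<noteq> 0}. g i)"
        using eq[OF f(1) conjunct2[OF sum[of _ g, OF fin ing]]] by (rule rev_iffD1)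
      then have "g = part f" using part_unique[of _ g, OF fin g(1)] by auto
      then show "c = (\<lambda>i. e (part f i))" by (simp add: c_eq)
    qed
  qed
  moreover have "r \<odot>\<^bsub>?M\<^esub> x \<in> mod_comp ?M (i + j)" if r: "r \<in> ring_comp R i" and x: "x \<in> mod_comp ?M j" for i j r x
  proof -
    obtain f where f: "f \<in> ?C j" "x = e f" using x by (auto simp: M_simps)
    have "deg u = of_int (i + j - n)" if u: "u \<in> Poly_Mapping.keys (r * f)" for u
    proof -
      obtain v w where "v \<in> Poly_Mapping.keys r" "w \<in> Poly_Mapping.keys f" "u = v + w"
        using u keys_mult[of r f] by blast
      then show ?thesis using r f by (auto simp: R_simps deg_add)
    qed
    moreover have "?in (r * f)" using r f by (intro in_times) (auto simp: R_simps)
    ultimately show ?thesis using f by (auto simp: M_simps M_smult)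
  qed
  ultimately show ?thesis
    unfolding is_graded_module_def using M.module_axioms by blast
qed

text \<open>The ideal generated by the monomials \<open>p\<close> and \<open>q\<close> is mapped to
  \<open>Q\<close> by sending the generators to \<open>vp\<close> and \<open>vq\<close>;
  \<open>compat\<close> is exactly what makes this well defined. Injectivity extends the map to the
  whole ring, and the image of 1 is \<open>v\<close>. The embedding \<open>e\<close> is there
  because injectivity of \<open>Q\<close> is tested only on modules with elements in
  \<open>'m\<close>.\<close>

lemma graded_injective_two_generators:
  fixes e :: "('a \<Rightarrow>\<^sub>0 'k) \<Rightarrow> 'm" and Q :: "('a \<Rightarrow>\<^sub>0 'k, 'm) graded_module"
  assumes inj: "inj_on e (carrier R)" and Q: "graded_injective R Q"
    and p: "p \<in> S" "deg p = of_int i" "vp \<in> mod_comp Q (n + i)"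
    and q: "q \<in> S" "deg q = of_int j" "vq \<in> mod_comp Q (n + j)"
    and compat: "\<And>r s. \<lbrakk>r \<in> carrier R; s \<in> carrier R;
        Poly_Mapping.single p 1 * r = Poly_Mapping.single q 1 * s\<rbrakk> \<Longrightarrow> r \<odot>\<^bsub>Q\<^esub> vp = s \<odot>\<^bsub>Q\<^esub> vq"
  obtains v where "v \<in> mod_comp Q n" "Poly_Mapping.single p 1 \<odot>\<^bsub>Q\<^esub> v = vp" "Poly_Mapping.single q 1 \<odot>\<^bsub>Q\<^esub> v = vq"
proof -
  have gQ: "is_graded_module R Q" using Q by (simp add: graded_injective_def)
  interpret Q: Module.module R Q using is_graded_moduleD(1)[OF gQ] .
  have vp: "vp \<in> carrier Q" and vq: "vq \<in> carrier Q"
    using p q is_graded_module_comp(1)[OF gQ] by auto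
  have injS: "inj_on e {f. Poly_Mapping.keys f \<subseteq> S}" using inj by (simp add: R_simps)
  let ?P = "Poly_Mapping.single p (1::'k)" and ?Q = "Poly_Mapping.single q (1::'k)"
  define T where "T = (+) p ` S \<union> (+) q ` S"
  have TS: "T \<subseteq> S" using p(1) q(1) by (auto simp: T_def add_mem)
  have Tadd: "u + v \<in> T" if "u \<in> S" "v \<in> T" for u v
    using that by (auto simp: T_def image_iff add_mem) (metis add.left_commute add_mem)+
  let ?M = "shifted_ideal deg S e T n" and ?N = "shifted_ideal deg S e S n"
  have M: "is_graded_module R ?M" and N: "is_graded_module R ?N"
    using graded_shifted_ideal[OF injS TS Tadd] graded_shifted_ideal[OF injS order.refl add_mem] by auto
  note M_simps = shifted_ideal_simps(1-3) and M_add = shifted_ideal_simps(4)[OF injS TS]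
    and M_smult = shifted_ideal_simps(5)[OF injS TS]
    and N_add = shifted_ideal_simps(4)[OF injS order.refl]
    and N_smult = shifted_ideal_simps(5)[OF injS order.refl]
  have inclusion: "id \<in> graded_hom R ?M ?N"
    using TS by (auto simp: graded_hom_def M_simps M_add M_smult N_add N_smult)
  \<comment> \<open>Two representations of one element differ by a relation between the two
    monomials, and \<open>compat\<close> equates the two sides of that relation.\<close>
  have uniq: "g \<odot>\<^bsub>Q\<^esub> vp \<oplus>\<^bsub>Q\<^esub> h \<odot>\<^bsub>Q\<^esub> vq = g' \<odot>\<^bsub>Q\<^esub> vp \<oplus>\<^bsub>Q\<^esub> h' \<odot>\<^bsub>Q\<^esub> vq"
    if "g \<in> carrier R" "h \<in> carrier R" "g' \<in> carrier R" "h' \<in> carrier R" "?P * g + ?Q * h = ?P * g' + ?Q * h'"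
    for g h g' h'
  proof -
    have mem: "g - g' \<in> carrier R" "h' - h \<in> carrier R"
      using that plus_mem[OF _ uminus_mem] by (metis diff_conv_add_uminus)+
    have "?P * (g - g') = ?Q * (h' - h)" using that(5) by (simp add: algebra_simps)
    then have D: "(g - g') \<odot>\<^bsub>Q\<^esub> vp = (h' - h) \<odot>\<^bsub>Q\<^esub> vq" using compat mem by blast
    have "g \<odot>\<^bsub>Q\<^esub> vp = (g - g') \<odot>\<^bsub>Q\<^esub> vp \<oplus>\<^bsub>Q\<^esub> g' \<odot>\<^bsub>Q\<^esub> vp"
      using Q.smult_l_distr[OF mem(1) that(3) vp] by (simp add: R_simps)
    moreover have "h' \<odot>\<^bsub>Q\<^esub> vq = (h' - h) \<odot>\<^bsub>Q\<^esub> vq \<oplus>\<^bsub>Q\<^esub> h \<odot>\<^bsub>Q\<^esub> vq"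
      using Q.smult_l_distr[OF mem(2) that(2) vq] by (simp add: R_simps)
    ultimately show ?thesis using D that mem vp vq by (simp add: Q.M.a_ac)
  qed
  \<comment> \<open>The representation of \<open>f\<close> is chosen arbitrarily; by
    \<open>uniq\<close> the value does not depend on it.\<close>
  define \<phi> where "\<phi> f = (SOME z. \<exists>g h. g \<in> carrier R \<and> h \<in> carrier R \<and> f = ?P * g + ?Q * h \<and>
      z = g \<odot>\<^bsub>Q\<^esub> vp \<oplus>\<^bsub>Q\<^esub> h \<odot>\<^bsub>Q\<^esub> vq)" for f
  have \<phi>: "\<phi> (?P * g + ?Q * h) = g \<odot>\<^bsub>Q\<^esub> vp \<oplus>\<^bsub>Q\<^esub> h \<odot>\<^bsub>Q\<^esub> vq" if "g \<in> carrier R" "h \<in> carrier R" for g h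
    unfolding \<phi>_def
  proof (rule some_equality)
    fix z
    assume "\<exists>g' h'. g' \<in> carrier R \<and> h' \<in> carrier R \<and> ?P * g + ?Q * h = ?P * g' + ?Q * h' \<and>
      z = g' \<odot>\<^bsub>Q\<^esub> vp \<oplus>\<^bsub>Q\<^esub> h' \<odot>\<^bsub>Q\<^esub> vq"
    then show "z = g \<odot>\<^bsub>Q\<^esub> vp \<oplus>\<^bsub>Q\<^esub> h \<odot>\<^bsub>Q\<^esub> vq"
      using uniq[OF that] by auto
  qed (use that in blast)
  have split: "\<exists>g h. g \<in> carrier R \<and> h \<in> carrier R \<and> f = ?P * g + ?Q * h \<and>
      (+) p ` Poly_Mapping.keys g \<subseteq> Poly_Mapping.keys f \<and> (+) q ` Poly_Mapping.keys h \<subseteq> Poly_Mapping.keys f"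
    if "Poly_Mapping.keys f \<subseteq> T" for f :: "'a \<Rightarrow>\<^sub>0 'k"
    using that unfolding T_def by (rule two_singles_times_exist) (auto simp: R_simps)
  define F where "F x = \<phi> (inv_into {f. Poly_Mapping.keys f \<subseteq> S} e x)" for x
  have F: "F (e f) = \<phi> f" if "Poly_Mapping.keys f \<subseteq> T" for f
    unfolding F_def using that TS by (subst inv_into_f_f[OF injS]) auto
  have "F \<in> graded_hom R ?M Q"
    unfolding graded_hom_def mem_Collect_eq
  proof (intro conjI ballI allI)
    show "F \<in> carrier ?M \<rightarrow> carrier Q"
      using split by (fastforce simp: M_simps F \<phi> vp vq)
  next
    fix x y assume "x \<in> carrier ?M" "y \<in> carrier ?M"
    then obtain f f' where f: "Poly_Mapping.keys f \<subseteq> T" "x = e f" and f': "Poly_Mapping.keys f' \<subseteq> T" "y = e f'"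
      by (auto simp: M_simps)
    obtain g h where g: "g \<in> carrier R" "h \<in> carrier R" "f = ?P * g + ?Q * h" using split[OF f(1)] by blast
    obtain g' h' where g': "g' \<in> carrier R" "h' \<in> carrier R" "f' = ?P * g' + ?Q * h'" using split[OF f'(1)] by blast
    have "f + f' = ?P * (g + g') + ?Q * (h + h')" using g g' by (simp add: algebra_simps)
    then have "\<phi> (f + f') = (g + g') \<odot>\<^bsub>Q\<^esub> vp \<oplus>\<^bsub>Q\<^esub> (h + h') \<odot>\<^bsub>Q\<^esub> vq"
      using \<phi> plus_mem g g' by simp
    also have "\<dots> = \<phi> f \<oplus>\<^bsub>Q\<^esub> \<phi> f'"
      using Q.smult_l_distr[OF g(1) g'(1) vp] Q.smult_l_distr[OF g(2) g'(2) vq] g g' vp vq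
      by (simp add: R_simps(5) \<phi> Q.M.a_ac)
    finally show "F (x \<oplus>\<^bsub>?M\<^esub> y) = F x \<oplus>\<^bsub>Q\<^esub> F y"
      using f f' by (simp add: M_add F keys_plus_subset)
  next
    fix r x assume r: "r \<in> carrier R" and "x \<in> carrier ?M"
    then obtain f where f: "Poly_Mapping.keys f \<subseteq> T" "x = e f" by (auto simp: M_simps)
    obtain g h where g: "g \<in> carrier R" "h \<in> carrier R" "f = ?P * g + ?Q * h" using split[OF f(1)] by blast
    have rf: "Poly_Mapping.keys (r * f) \<subseteq> T" using keys_times_subset[OF _ f(1) Tadd] r by (simp add: R_simps)
    have "r * f = ?P * (r * g) + ?Q * (r * h)" using g by (simp add: algebra_simps)
    then have "\<phi> (r * f) = (r * g) \<odot>\<^bsub>Q\<^esub> vp \<oplus>\<^bsub>Q\<^esub> (r * h) \<odot>\<^bsub>Q\<^esub> vq"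
      using \<phi> times_mem g r by simp
    also have "\<dots> = r \<odot>\<^bsub>Q\<^esub> \<phi> f"
      using Q.smult_assoc1[OF r g(1) vp] Q.smult_assoc1[OF r g(2) vq] g r vp vq
      by (simp add: R_simps(2) \<phi> Q.smult_r_distr)
    finally show "F (r \<odot>\<^bsub>?M\<^esub> x) = r \<odot>\<^bsub>Q\<^esub> F x"
      using f rf by (simp add: M_smult F)
  next
    fix l
    show "F ` mod_comp ?M l \<subseteq> mod_comp Q l"
    proof
      fix z assume "z \<in> F ` mod_comp ?M l"
      then obtain f where f: "Poly_Mapping.keys f \<subseteq> T" "\<forall>u \<in> Poly_Mapping.keys f. deg u = of_int (l - n)" "z = F (e f)"
        by (auto simp: M_simps)
      obtain g h where g: "g \<in> carrier R" "h \<in> carrier R" "f = ?P * g + ?Q * h"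
        "(+) p ` Poly_Mapping.keys g \<subseteq> Poly_Mapping.keys f" "(+) q ` Poly_Mapping.keys h \<subseteq> Poly_Mapping.keys f"
        using split[OF f(1)] by blast
      \<comment> \<open>The supports of \<open>g\<close> and \<open>h\<close>, shifted by
        \<open>p\<close> and \<open>q\<close>, lie in that of \<open>f\<close>, which fixes their
        degrees. Together with the degrees \<open>n + i\<close> of \<open>vp\<close> and
        \<open>n + j\<close> of \<open>vq\<close>, both products land in degree
        \<open>l\<close>.\<close>
      have "g \<in> ring_comp R (l - n - i)" "h \<in> ring_comp R (l - n - j)"
        using g f(2) p(2) q(2) by (force simp: R_simps deg_add image_subset_iff)+
      then have "g \<odot>\<^bsub>Q\<^esub> vp \<in> mod_comp Q l" "h \<odot>\<^bsub>Q\<^esub> vq \<in> mod_comp Q l"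
        using is_graded_moduleD(4)[OF gQ _ p(3)] is_graded_moduleD(4)[OF gQ _ q(3)] by force+
      then show "z \<in> mod_comp Q l"
        using is_graded_module_comp(3)[OF gQ] f g by (simp add: F \<phi>)
    qed
  qed
  then have "\<exists>G\<in>graded_hom R ?N Q. \<forall>x \<in> carrier ?M. G (id x) = F x"
    by (intro graded_injectiveD[OF Q M N inclusion]) auto
  then obtain G where G: "G \<in> graded_hom R ?N Q" "\<forall>x \<in> carrier ?M. G x = F x"
    by auto
  have one: "Poly_Mapping.keys (1::'a \<Rightarrow>\<^sub>0 'k) \<subseteq> S" using zero_mem by simp
  have "deg 0 = 0" using deg_add[of 0 0] by simp
  \<comment> \<open>In the shifted ring the unit has degree \<open>n\<close>. Its image is the
    required element, since multiplying it by \<open>r\<close> gives \<open>\<phi> r\<close> for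
    \<open>r\<close> supported in \<open>T\<close>.\<close>
  then have "G (e 1) \<in> mod_comp Q n"
    using graded_homD(4)[OF G(1), of "e 1" n] zero_mem by (auto simp: M_simps)
  moreover have "r \<odot>\<^bsub>Q\<^esub> G (e 1) = \<phi> r" if "Poly_Mapping.keys r \<subseteq> T" for r
  proof -
    have "r \<odot>\<^bsub>Q\<^esub> G (e 1) = G (r \<odot>\<^bsub>?N\<^esub> e 1)"
      using graded_homD(3)[OF G(1)] that TS one by (auto simp: R_simps M_simps)
    also have "\<dots> = F (e r)" using G(2) that one by (auto simp: N_smult M_simps)
    finally show ?thesis using F that by simp
  qed
  moreover have "\<phi> ?P = vp" "\<phi> ?Q = vq"
    using \<phi>[of 1 0] \<phi>[of 0 1] zero_mem vp vq Q.smult_one Q.smult_l_null by (auto simp: R_simps)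
  moreover have "p \<in> T" "q \<in> T" using zero_mem by (auto simp: T_def image_iff intro: bexI[of _ 0])
  ultimately show thesis using that by auto
qed

end

section \<open>Second local cohomology with two parameters\<close>

text \<open>\<open>X n\<close> and \<open>Y n\<close> are the exponents of the n-th powers of two
  parameters of degree 1. For \<open>c\<close> = 0, \<open>syzygy_mem\<close> expresses regularity
  of the pair; a positive \<open>c\<close> allows rings in which only a power of the parameters
  repairs the relations. \<open>high_degree\<close> puts a power of the maximal ideal into the ideal
  generated by the q-th powers of the parameters.\<close>

locale two_parameters = graded_semigroup_ring S deg R
  for S :: "'a::cancel_comm_monoid_add set" and deg :: "'a \<Rightarrow> real" and R :: "('a \<Rightarrow>\<^sub>0 'k::field) graded_ring" +
  fixes X Y :: "nat \<Rightarrow> 'a" and c :: nat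
  assumes X_mem: "X n \<in> S" and X_add: "X (m + n) = X m + X n" and deg_X: "deg (X n) = of_nat n"
    and Y_mem: "Y n \<in> S" and Y_add: "Y (m + n) = Y m + Y n" and deg_Y: "deg (Y n) = of_nat n"
    and deg_pos: "u \<in> S \<Longrightarrow> u \<noteq> 0 \<Longrightarrow> 1 \<le> deg u"
    and syzygy_mem: "u \<in> S \<Longrightarrow> v \<in> S \<Longrightarrow> X (p + c) + u = Y (p + c) + v \<Longrightarrow> X c + u \<in> (+) (Y p) ` S"
    and high_degree: "\<exists>n::nat. \<forall>u \<in> S. real n \<le> deg u \<longrightarrow> u \<in> (+) (X q) ` S \<union> (+) (Y q) ` S"
begin

definition x :: "nat \<Rightarrow> 'a \<Rightarrow>\<^sub>0 'k" where "x n = Poly_Mapping.single (X n) 1"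
definition y :: "nat \<Rightarrow> 'a \<Rightarrow>\<^sub>0 'k" where "y n = Poly_Mapping.single (Y n) 1"

lemma xy_mem: "x n \<in> carrier R" "y n \<in> carrier R" "x n \<in> ring_comp R (int n)" "y n \<in> ring_comp R (int n)"
  by (simp_all add: x_def y_def R_simps X_mem Y_mem deg_X deg_Y)

lemma xy_add: "x m * x n = x (m + n)" "y m * y n = y (m + n)"
  by (simp_all add: x_def y_def mult_single X_add Y_add)

text \<open>By \<open>syzygy_mem\<close> every term of \<open>x c * r\<close> is divisible by
  \<open>y p\<close>, which yields \<open>t\<close>. The second equality follows from the given
  relation after cancelling \<open>y p\<close>.\<close>

lemma syzygy:
  assumes r: "r \<in> carrier R" and s: "s \<in> carrier R" and eq: "x (p + c) * r = y (p + c) * s"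
  obtains t where "t \<in> carrier R" "x c * r = y p * t" "y c * s = x p * t"
proof -
  have "Poly_Mapping.keys (x c * r) \<subseteq> (+) (Y p) ` S"
  proof
    fix u' assume "u' \<in> Poly_Mapping.keys (x c * r)"
    then obtain u where u: "u \<in> Poly_Mapping.keys r" "u' = X c + u"
      by (auto simp: x_def keys_single_times)
    then have "X (p + c) + u \<in> Poly_Mapping.keys (y (p + c) * s)"
      by (auto simp: eq[symmetric] x_def keys_single_times)
    then obtain v where "v \<in> Poly_Mapping.keys s" "X (p + c) + u = Y (p + c) + v"
      by (auto simp: y_def keys_single_times)
    then show "u' \<in> (+) (Y p) ` S"
      using u r s syzygy_mem[of u v p] by (auto simp: R_simps)
  qed
  then obtain t where t: "Poly_Mapping.keys t \<subseteq> S" "x c * r = y p * t"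
    unfolding y_def by (rule single_times_exists)
  have "y p * (x p * t) = x p * (y p * t)" by (rule mult.left_commute)
  also have "\<dots> = x p * (x c * r)" by (simp only: t(2))
  also have "\<dots> = y p * (y c * s)" using eq by (simp flip: mult.assoc add: xy_add)
  finally have "x p * t = y c * s" unfolding y_def by (rule single_times_cancel)
  with t that show thesis by (simp add: R_simps)
qed

section \<open>Torsion with respect to the maximal ideal\<close>

text \<open>Each factor from the maximal ideal raises the degree of every term by at least 1, by
  \<open>deg_pos\<close>.\<close>

lemma keys_ideal_power:
  "f \<in> semigroup_ring_max_ideal S [^]\<^bsub>ideals_set R\<^esub> (n::nat) \<Longrightarrow> Poly_Mapping.keys f \<subseteq> {u \<in> S. real n \<le> deg u}"
proof (induction n arbitrary: f)
  case 0
  have "0 \<le> deg u" if "u \<in> S" for u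
    using deg_pos[OF that] deg_add[of 0 0] by (cases "u = 0") auto
  then show ?case using 0 by (auto simp: nat_pow_def ideals_set_def R_simps)
next
  case (Suc n)
  let ?J = "semigroup_ring_max_ideal S :: ('a \<Rightarrow>\<^sub>0 'k) set"
  have "f \<in> ideal_prod R (?J [^]\<^bsub>ideals_set R\<^esub> n) ?J"
    using Suc.prems by (simp add: nat_pow_def ideals_set_def)
  then show ?case
  proof (induction rule: ideal_prod.induct)
    case (prod f g)
    have "u + v \<in> S \<and> real (Suc n) \<le> deg (u + v)" if "u \<in> S" "real n \<le> deg u" "v \<in> S - {0}" for u v
      using that deg_pos[of v] by (auto simp: deg_add add_mem)
    then show ?case
      using Suc.IH[OF prod(1)] prod(2) unfolding R_simps(2)
      by (intro keys_times_subset) (auto simp: semigroup_ring_max_ideal_def)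
  qed (simp add: R_simps(5) keys_plus_subset)
qed

lemma xy_ideal_power:
  "x n \<in> semigroup_ring_max_ideal S [^]\<^bsub>ideals_set R\<^esub> n" "y n \<in> semigroup_ring_max_ideal S [^]\<^bsub>ideals_set R\<^esub> n"
proof (induction n)
  case 0
  show "x 0 \<in> semigroup_ring_max_ideal S [^]\<^bsub>ideals_set R\<^esub> (0::nat)"
    "y 0 \<in> semigroup_ring_max_ideal S [^]\<^bsub>ideals_set R\<^esub> (0::nat)"
    using xy_mem[of 0] by (simp_all add: nat_pow_def ideals_set_def)
next
  case (Suc n)
  have "deg 0 = 0" using deg_add[of 0 0] by simp
  then have "X 1 \<noteq> 0" "Y 1 \<noteq> 0" using deg_X[of 1] deg_Y[of 1] by auto
  then have one: "x 1 \<in> semigroup_ring_max_ideal S" "y 1 \<in> semigroup_ring_max_ideal S"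
    by (simp_all add: x_def y_def semigroup_ring_max_ideal_def X_mem Y_mem)
  show "x (Suc n) \<in> semigroup_ring_max_ideal S [^]\<^bsub>ideals_set R\<^esub> (Suc n)"
    "y (Suc n) \<in> semigroup_ring_max_ideal S [^]\<^bsub>ideals_set R\<^esub> (Suc n)"
    using ideal_prod.prod[OF Suc(1) one(1), of R] ideal_prod.prod[OF Suc(2) one(2), of R]
    by (simp_all add: nat_pow_def ideals_set_def R_simps(2) xy_add)
qed

context
  fixes M :: "('a \<Rightarrow>\<^sub>0 'k, 'm) graded_module"
  assumes M: "is_graded_module R M"
begin

interpretation M: Module.module R M
  using is_graded_moduleD(1)[OF M] .

lemma smult_times: "r \<in> carrier R \<Longrightarrow> s \<in> carrier R \<Longrightarrow> v \<in> carrier M \<Longrightarrow> r \<odot>\<^bsub>M\<^esub> (s \<odot>\<^bsub>M\<^esub> v) = (r * s) \<odot>\<^bsub>M\<^esub> v"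
  using M.smult_assoc1[of r s v] by (simp add: R_simps(2))

lemma xy_smult:
  assumes "v \<in> carrier M"
  shows "x m \<odot>\<^bsub>M\<^esub> (x n \<odot>\<^bsub>M\<^esub> v) = x (m + n) \<odot>\<^bsub>M\<^esub> v" "y m \<odot>\<^bsub>M\<^esub> (y n \<odot>\<^bsub>M\<^esub> v) = y (m + n) \<odot>\<^bsub>M\<^esub> v"
    "y m \<odot>\<^bsub>M\<^esub> (x n \<odot>\<^bsub>M\<^esub> v) = x n \<odot>\<^bsub>M\<^esub> (y m \<odot>\<^bsub>M\<^esub> v)"
  using assms by (simp_all add: smult_times xy_mem xy_add mult.commute)

lemma xy_comp: "v \<in> mod_comp M i \<Longrightarrow> x n \<odot>\<^bsub>M\<^esub> v \<in> mod_comp M (i + n)" "v \<in> mod_comp M i \<Longrightarrow> y n \<odot>\<^bsub>M\<^esub> v \<in> mod_comp M (i + n)"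
  using is_graded_moduleD(4)[OF M xy_mem(3), of v i n] is_graded_moduleD(4)[OF M xy_mem(4), of v i n]
  by (simp_all add: add.commute)

lemma smult_minus: "r \<in> carrier R \<Longrightarrow> v \<in> carrier M \<Longrightarrow> w \<in> carrier M \<Longrightarrow>
    r \<odot>\<^bsub>M\<^esub> (v \<ominus>\<^bsub>M\<^esub> w) = r \<odot>\<^bsub>M\<^esub> v \<ominus>\<^bsub>M\<^esub> r \<odot>\<^bsub>M\<^esub> w"
  by (simp add: M.minus_eq M.smult_r_distr M.smult_r_minus)

text \<open>The powers of the maximal ideal and the ideals generated by \<open>x q\<close> and
  \<open>y q\<close> are cofinal. One direction uses that \<open>x n\<close> and \<open>y n\<close>
  lie in the n-th power; the other uses that a high power has only terms of high degree, each
  divisible by \<open>x q\<close> or \<open>y q\<close>.\<close>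

lemma torsion_iff:
  "v \<in> torsion R (semigroup_ring_max_ideal S) M \<longleftrightarrow>
    v \<in> carrier M \<and> (\<exists>q. x q \<odot>\<^bsub>M\<^esub> v = \<zero>\<^bsub>M\<^esub> \<and> y q \<odot>\<^bsub>M\<^esub> v = \<zero>\<^bsub>M\<^esub>)"
proof
  assume "v \<in> torsion R (semigroup_ring_max_ideal S) M"
  then show "v \<in> carrier M \<and> (\<exists>q. x q \<odot>\<^bsub>M\<^esub> v = \<zero>\<^bsub>M\<^esub> \<and> y q \<odot>\<^bsub>M\<^esub> v = \<zero>\<^bsub>M\<^esub>)"
    unfolding torsion_def using xy_ideal_power by blast
next
  assume "v \<in> carrier M \<and> (\<exists>q. x q \<odot>\<^bsub>M\<^esub> v = \<zero>\<^bsub>M\<^esub> \<and> y q \<odot>\<^bsub>M\<^esub> v = \<zero>\<^bsub>M\<^esub>)"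
  then obtain q where v: "v \<in> carrier M" and q: "x q \<odot>\<^bsub>M\<^esub> v = \<zero>\<^bsub>M\<^esub>" "y q \<odot>\<^bsub>M\<^esub> v = \<zero>\<^bsub>M\<^esub>" by blast
  obtain n :: nat where n: "\<forall>u \<in> S. real n \<le> deg u \<longrightarrow> u \<in> (+) (X q) ` S \<union> (+) (Y q) ` S"
    using high_degree by blast
  have "f \<odot>\<^bsub>M\<^esub> v = \<zero>\<^bsub>M\<^esub>" if "f \<in> semigroup_ring_max_ideal S [^]\<^bsub>ideals_set R\<^esub> n" for f
  proof -
    have "Poly_Mapping.keys f \<subseteq> (+) (X q) ` S \<union> (+) (Y q) ` S"
      using keys_ideal_power[OF that] n by blast
    then obtain g h where gh: "Poly_Mapping.keys g \<subseteq> S" "Poly_Mapping.keys h \<subseteq> S" "f = x q * g + y q * h"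
      unfolding x_def y_def by (rule two_singles_times_exist)
    have g: "g \<in> carrier R" and h: "h \<in> carrier R" using gh by (simp_all add: R_simps)
    have "f \<odot>\<^bsub>M\<^esub> v = (g * x q) \<odot>\<^bsub>M\<^esub> v \<oplus>\<^bsub>M\<^esub> (h * y q) \<odot>\<^bsub>M\<^esub> v"
      using M.smult_l_distr[OF times_mem[OF g xy_mem(1)] times_mem[OF h xy_mem(2)] v]
      by (simp add: gh(3) R_simps(5) mult.commute)
    also have "\<dots> = \<zero>\<^bsub>M\<^esub>"
      using g h q by (simp flip: smult_times[OF g xy_mem(1) v] smult_times[OF h xy_mem(2) v])
    finally show ?thesis .
  qed
  then show "v \<in> torsion R (semigroup_ring_max_ideal S) M"
    using v unfolding torsion_def by blast
qed

end

section \<open>Quotients in graded injective modules\<close>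

text \<open>The extension property is applied to the monomials \<open>x (p + c)\<close> and
  \<open>y (p + c)\<close> with targets x^c vx and y^c vy. A relation between these monomials with
  coefficients \<open>r\<close> and \<open>s\<close> becomes, by \<open>syzygy\<close>, a multiple
  \<open>t\<close> of the Koszul relation, so r x^c vx = t y^p vx = t x^p vy = s y^c vy.\<close>

lemma common_quotient:
  fixes e :: "('a \<Rightarrow>\<^sub>0 'k) \<Rightarrow> 'm" and Q :: "('a \<Rightarrow>\<^sub>0 'k, 'm) graded_module"
  assumes inj: "inj_on e (carrier R)" and Q: "graded_injective R Q"
    and vx: "vx \<in> mod_comp Q (n + int p)" and vy: "vy \<in> mod_comp Q (n + int p)"
    and eq: "y p \<odot>\<^bsub>Q\<^esub> vx = x p \<odot>\<^bsub>Q\<^esub> vy"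
  obtains v where "v \<in> mod_comp Q n" "x (p + c) \<odot>\<^bsub>Q\<^esub> v = x c \<odot>\<^bsub>Q\<^esub> vx" "y (p + c) \<odot>\<^bsub>Q\<^esub> v = y c \<odot>\<^bsub>Q\<^esub> vy"
proof -
  have gQ: "is_graded_module R Q" using Q by (simp add: graded_injective_def)
  interpret Q: Module.module R Q using is_graded_moduleD(1)[OF gQ] .
  have carr: "vx \<in> carrier Q" "vy \<in> carrier Q" using is_graded_module_comp(1)[OF gQ] vx vy by auto
  show thesis
  proof (rule graded_injective_two_generators[OF inj Q X_mem[of "p + c"] _ _ Y_mem[of "p + c"]])
    show "deg (X (p + c)) = of_int (int (p + c))" "deg (Y (p + c)) = of_int (int (p + c))"
      by (simp_all add: deg_X deg_Y)
    show "x c \<odot>\<^bsub>Q\<^esub> vx \<in> mod_comp Q (n + int (p + c))" "y c \<odot>\<^bsub>Q\<^esub> vy \<in> mod_comp Q (n + int (p + c))"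
      using xy_comp[OF gQ] vx vy by (metis add.assoc of_nat_add)+
    fix r s assume r: "r \<in> carrier R" and s: "s \<in> carrier R"
      and "Poly_Mapping.single (X (p + c)) 1 * r = Poly_Mapping.single (Y (p + c)) 1 * s"
    then obtain t where t: "t \<in> carrier R" "x c * r = y p * t" "y c * s = x p * t"
      using syzygy[OF r s] unfolding x_def y_def by blast
    have "r \<odot>\<^bsub>Q\<^esub> (x c \<odot>\<^bsub>Q\<^esub> vx) = (x c * r) \<odot>\<^bsub>Q\<^esub> vx"
      using r carr by (simp add: smult_times[OF gQ] xy_mem mult.commute)
    also have "\<dots> = t \<odot>\<^bsub>Q\<^esub> (y p \<odot>\<^bsub>Q\<^esub> vx)"
      using t carr by (simp add: smult_times[OF gQ] xy_mem mult.commute)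
    also have "\<dots> = (y c * s) \<odot>\<^bsub>Q\<^esub> vy"
      using t carr by (simp add: eq smult_times[OF gQ] xy_mem mult.commute)
    also have "\<dots> = s \<odot>\<^bsub>Q\<^esub> (y c \<odot>\<^bsub>Q\<^esub> vy)"
      using s carr by (simp add: smult_times[OF gQ] xy_mem mult.commute)
    finally show "r \<odot>\<^bsub>Q\<^esub> (x c \<odot>\<^bsub>Q\<^esub> vx) = s \<odot>\<^bsub>Q\<^esub> (y c \<odot>\<^bsub>Q\<^esub> vy)" .
  qed (use that in \<open>simp add: x_def y_def\<close>)
qed

text \<open>This is the extension property with both generators equal to \<open>y p\<close> and both
  targets equal to \<open>w\<close>. Compatibility holds because monomials can be cancelled.\<close>

lemma y_divisible:
  fixes e :: "('a \<Rightarrow>\<^sub>0 'k) \<Rightarrow> 'm" and Q :: "('a \<Rightarrow>\<^sub>0 'k, 'm) graded_module"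
  assumes inj: "inj_on e (carrier R)" and Q: "graded_injective R Q" and w: "w \<in> mod_comp Q (n + int p)"
  obtains v where "v \<in> mod_comp Q n" "y p \<odot>\<^bsub>Q\<^esub> v = w"
proof (rule graded_injective_two_generators[OF inj Q Y_mem[of p] _ w Y_mem[of p] _ w])
  show "deg (Y p) = of_int (int p)" "deg (Y p) = of_int (int p)" by (simp_all add: deg_Y)
qed (use that single_times_cancel in \<open>auto simp: y_def\<close>)

end

section \<open>Degreewise exactness of a graded injective resolution\<close>

locale resolved_two_parameters = two_parameters S deg R X Y c
  for S :: "'a::cancel_comm_monoid_add set" and deg :: "'a \<Rightarrow> real" and R :: "('a \<Rightarrow>\<^sub>0 'k::field) graded_ring"
    and X Y :: "nat \<Rightarrow> 'a" and c :: nat +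
  fixes \<epsilon> :: "('a \<Rightarrow>\<^sub>0 'k) \<Rightarrow> 'm" and I :: "nat \<Rightarrow> ('a \<Rightarrow>\<^sub>0 'k, 'm) graded_module" and \<delta> :: "nat \<Rightarrow> 'm \<Rightarrow> 'm"
  assumes resolution: "graded_injective_resolution R (regular_module R) \<epsilon> I \<delta>"
begin

lemma injective: "graded_injective R (I j)"
  and hom_\<epsilon>: "\<epsilon> \<in> graded_hom R (regular_module R) (I 0)"
  and hom_\<delta>: "\<delta> j \<in> graded_hom R (I j) (I (Suc j))"
  and inj_\<epsilon>: "inj_on \<epsilon> (carrier R)"
  and exact_\<epsilon>: "\<epsilon> ` carrier R = {v \<in> carrier (I 0). \<delta> 0 v = \<zero>\<^bsub>I (Suc 0)\<^esub>}"
  and exact_\<delta>: "\<delta> j ` carrier (I j) = {v \<in> carrier (I (Suc j)). \<delta> (Suc j) v = \<zero>\<^bsub>I (Suc (Suc j))\<^esub>}"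
  and graded_regular: "is_graded_module R (regular_module R)"
  using resolution by (simp_all add: graded_injective_resolution_def regular_module_def)

lemma graded_I: "is_graded_module R (I j)"
  using injective by (simp add: graded_injective_def)

sublocale I: Module.module R "I j" for j
  using is_graded_moduleD(1)[OF graded_I] .

lemma comp_carrier: "v \<in> mod_comp (I j) n \<Longrightarrow> v \<in> carrier (I j)"
  by (rule is_graded_module_comp(1)[OF graded_I])

lemma \<epsilon>:
  assumes "f \<in> carrier R"
  shows "\<epsilon> f \<in> carrier (I 0)" "g \<in> carrier R \<Longrightarrow> \<epsilon> (f + g) = \<epsilon> f \<oplus>\<^bsub>I 0\<^esub> \<epsilon> g"
    "g \<in> carrier R \<Longrightarrow> \<epsilon> (g * f) = g \<odot>\<^bsub>I 0\<^esub> \<epsilon> f" "f \<in> ring_comp R n \<Longrightarrow> \<epsilon> f \<in> mod_comp (I 0) n"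
    "\<delta> 0 (\<epsilon> f) = \<zero>\<^bsub>I (Suc 0)\<^esub>"
  using assms graded_homD[OF hom_\<epsilon>] exact_\<epsilon> by (auto simp: regular_module_def R_simps)

lemma \<delta>:
  assumes "v \<in> carrier (I j)"
  shows "\<delta> j v \<in> carrier (I (Suc j))"
    "w \<in> carrier (I j) \<Longrightarrow> \<delta> j (v \<oplus>\<^bsub>I j\<^esub> w) = \<delta> j v \<oplus>\<^bsub>I (Suc j)\<^esub> \<delta> j w"
    "w \<in> carrier (I j) \<Longrightarrow> \<delta> j (v \<ominus>\<^bsub>I j\<^esub> w) = \<delta> j v \<ominus>\<^bsub>I (Suc j)\<^esub> \<delta> j w"
    "r \<in> carrier R \<Longrightarrow> \<delta> j (r \<odot>\<^bsub>I j\<^esub> v) = r \<odot>\<^bsub>I (Suc j)\<^esub> \<delta> j v"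
    "v \<in> mod_comp (I j) n \<Longrightarrow> \<delta> j v \<in> mod_comp (I (Suc j)) n"
    "\<delta> (Suc j) (\<delta> j v) = \<zero>\<^bsub>I (Suc (Suc j))\<^esub>"
  using assms graded_homD[OF hom_\<delta>] exact_\<delta>[of j]
    graded_hom_minus(2)[OF I.module_axioms I.module_axioms hom_\<delta>] by auto

lemma exact_\<delta>D:
  assumes "v \<in> carrier (I (Suc j))" "\<delta> (Suc j) v = \<zero>\<^bsub>I (Suc (Suc j))\<^esub>"
  obtains w where "w \<in> carrier (I j)" "\<delta> j w = v"
proof -
  have "v \<in> \<delta> j ` carrier (I j)" unfolding exact_\<delta> using assms by simp
  then show thesis using that by auto
qed

lemma exact_\<epsilon>D:
  assumes "v \<in> carrier (I 0)" "\<delta> 0 v = \<zero>\<^bsub>I (Suc 0)\<^esub>"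
  obtains f where "f \<in> carrier R" "\<epsilon> f = v"
proof -
  have "v \<in> \<epsilon> ` carrier R" unfolding exact_\<epsilon> using assms by simp
  then show thesis using that by auto
qed

text \<open>Exactness supplies some preimage, which need not be homogeneous; its component of degree
  \<open>n\<close> has the same image.\<close>

lemma kernel_\<delta>:
  assumes "v \<in> mod_comp (I (Suc j)) n" "\<delta> (Suc j) v = \<zero>\<^bsub>I (Suc (Suc j))\<^esub>"
  obtains w where "w \<in> mod_comp (I j) n" "\<delta> j w = v"
proof -
  obtain w where w: "w \<in> carrier (I j)" "\<delta> j w = v"
    by (rule exact_\<delta>D[OF comp_carrier[OF assms(1)] assms(2)])
  show thesis
    by (rule graded_hom_homogeneous_preimage[OF graded_I graded_I hom_\<delta> w(1), of n])
      (use assms(1) w(2) that in simp_all)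
qed

lemma kernel_\<delta>_0:
  assumes "v \<in> mod_comp (I 0) n" "\<delta> 0 v = \<zero>\<^bsub>I (Suc 0)\<^esub>"
  obtains f where "f \<in> ring_comp R n" "\<epsilon> f = v"
proof -
  obtain f where f: "f \<in> carrier R" "\<epsilon> f = v"
    by (rule exact_\<epsilon>D[OF comp_carrier[OF assms(1)] assms(2)])
  show thesis
    by (rule graded_hom_homogeneous_preimage[OF graded_regular graded_I hom_\<epsilon>, of f n])
      (use assms(1) f that in \<open>simp_all add: regular_module_def\<close>)
qed

lemma minus_self: "v \<in> carrier (I j) \<Longrightarrow> v \<ominus>\<^bsub>I j\<^esub> v = \<zero>\<^bsub>I j\<^esub>"
  by (simp add: a_minus_def I.M.r_neg)

lemma minus_zero: "v \<in> carrier (I j) \<Longrightarrow> v \<ominus>\<^bsub>I j\<^esub> \<zero>\<^bsub>I j\<^esub> = v"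
  by (simp add: a_minus_def)

lemma minus_add_cancel:
  assumes "v \<in> carrier (I j)" "w \<in> carrier (I j)"
  shows "(v \<ominus>\<^bsub>I j\<^esub> w) \<oplus>\<^bsub>I j\<^esub> w = v" "w \<oplus>\<^bsub>I j\<^esub> (v \<ominus>\<^bsub>I j\<^esub> w) = v"
proof -
  show "(v \<ominus>\<^bsub>I j\<^esub> w) \<oplus>\<^bsub>I j\<^esub> w = v"
    using assms by (simp add: a_minus_def I.M.a_assoc I.M.l_neg)
  then show "w \<oplus>\<^bsub>I j\<^esub> (v \<ominus>\<^bsub>I j\<^esub> w) = v"
    using assms by (simp add: I.M.a_comm)
qed

section \<open>Second cohomology classes and fractions\<close>

abbreviation "J \<equiv> semigroup_ring_max_ideal S"

text \<open>If \<open>z = \<delta> w\<close>, \<open>x\<^sup>p w = \<delta> v\<^sub>x\<close> and \<open>y\<^sup>p w = \<delta> v\<^sub>y\<close>, then \<open>y\<^sup>p v\<^sub>x - x\<^sup>p v\<^sub>y = \<epsilon> r\<close>, and the class of the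
  cocycle \<open>z\<close> corresponds to the class of \<open>r / (x\<^sup>p y\<^sup>p)\<close> in \<open>R\<^sub>x\<^sub>y / (R\<^sub>x + R\<^sub>y)\<close>. The hypothesis says that
  this quotient has no monomial of degree \<open>n\<close>.\<close>

lemma cocycle_is_coboundary:
  assumes z: "z \<in> cocycles R J I \<delta> 2" "z \<in> mod_comp (I 2) n"
    and fraction: "\<And>p u. u \<in> S \<Longrightarrow> deg u = of_int n + 2 * real p \<Longrightarrow>
      \<exists>q. X q + Y q + u \<in> (+) (Y (p + q)) ` S \<union> (+) (X (p + q)) ` S"
  shows "z \<in> coboundaries R J I \<delta> 2"
proof -
  have z2: "z \<in> mod_comp (I (Suc 1)) n" "\<delta> (Suc 1) z = \<zero>\<^bsub>I (Suc (Suc 1))\<^esub>"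
    using z by (simp_all add: cocycles_def numeral_2_eq_2)
  obtain p where p: "x p \<odot>\<^bsub>I (Suc 1)\<^esub> z = \<zero>\<^bsub>I (Suc 1)\<^esub>" "y p \<odot>\<^bsub>I (Suc 1)\<^esub> z = \<zero>\<^bsub>I (Suc 1)\<^esub>"
    using z(1) torsion_iff[OF graded_I] by (auto simp: cocycles_def numeral_2_eq_2)
  obtain w where w: "w \<in> mod_comp (I 1) n" "\<delta> 1 w = z"
    by (rule kernel_\<delta>[OF z2])
  note wc = comp_carrier[OF w(1)]
  \<comment> \<open>Although \<open>w\<close> need not be a cocycle, its multiples by x^p and y^p
    are, since both powers annihilate \<open>z\<close>. They therefore lift to degree
    \<open>n + p\<close> of \<open>I 0\<close>.\<close>
  have "\<delta> 1 (x p \<odot>\<^bsub>I 1\<^esub> w) = \<zero>\<^bsub>I (Suc 1)\<^esub>" "\<delta> 1 (y p \<odot>\<^bsub>I 1\<^esub> w) = \<zero>\<^bsub>I (Suc 1)\<^esub>"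
    using p w wc by (simp_all add: \<delta>(4) xy_mem)
  note kx = kernel_\<delta>[of "x p \<odot>\<^bsub>I 1\<^esub> w" 0 "n + p", unfolded One_nat_def[symmetric], OF xy_comp(1)[OF graded_I w(1)] this(1)]
    and ky = kernel_\<delta>[of "y p \<odot>\<^bsub>I 1\<^esub> w" 0 "n + p", unfolded One_nat_def[symmetric], OF xy_comp(2)[OF graded_I w(1)] this(2)]
  obtain vx where vx: "vx \<in> mod_comp (I 0) (n + p)" "\<delta> 0 vx = x p \<odot>\<^bsub>I 1\<^esub> w"
    by (rule kx)
  obtain vy where vy: "vy \<in> mod_comp (I 0) (n + p)" "\<delta> 0 vy = y p \<odot>\<^bsub>I 1\<^esub> w"
    by (rule ky)
  note vxc = comp_carrier[OF vx(1)] and vyc = comp_carrier[OF vy(1)]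
  have comp2: "y p \<odot>\<^bsub>I 0\<^esub> vx \<ominus>\<^bsub>I 0\<^esub> x p \<odot>\<^bsub>I 0\<^esub> vy \<in> mod_comp (I 0) (n + 2 * p)"
  proof -
    have "y p \<odot>\<^bsub>I 0\<^esub> vx \<in> mod_comp (I 0) (n + 2 * p)" "x p \<odot>\<^bsub>I 0\<^esub> vy \<in> mod_comp (I 0) (n + 2 * p)"
      using xy_comp(2)[OF graded_I vx(1), of p] xy_comp(1)[OF graded_I vy(1), of p] by (simp_all add: algebra_simps)
    then show ?thesis
      using subgroup.m_inv_closed[OF is_graded_moduleD(3)[OF graded_I[of 0]]] is_graded_module_comp(3)[OF graded_I[of 0]]
      by (simp add: a_minus_def a_inv_def)
  qed
  \<comment> \<open>Both terms are sent to x^p y^p w, so their difference comes from the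
    ring.\<close>
  have "\<delta> 0 (y p \<odot>\<^bsub>I 0\<^esub> vx \<ominus>\<^bsub>I 0\<^esub> x p \<odot>\<^bsub>I 0\<^esub> vy) = y p \<odot>\<^bsub>I 1\<^esub> \<delta> 0 vx \<ominus>\<^bsub>I 1\<^esub> x p \<odot>\<^bsub>I 1\<^esub> \<delta> 0 vy"
    using vxc vyc by (simp add: \<delta>(3,4) xy_mem)
  also have "\<dots> = \<zero>\<^bsub>I 1\<^esub>"
    using vx(2) vy(2) wc by (simp add: xy_smult[OF graded_I] xy_mem minus_self)
  finally obtain r where r: "r \<in> ring_comp R (n + 2 * p)" "\<epsilon> r = y p \<odot>\<^bsub>I 0\<^esub> vx \<ominus>\<^bsub>I 0\<^esub> x p \<odot>\<^bsub>I 0\<^esub> vy"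
    using kernel_\<delta>_0[OF comp2] by auto
  have rc: "r \<in> carrier R" using r(1) by (simp add: R_simps)
  let ?F = "\<lambda>u q. X q + Y q + u \<in> (+) (Y (p + q)) ` S \<union> (+) (X (p + q)) ` S"
  \<comment> \<open>\<open>?F u q\<close> says that the monomial u / (x^p y^p), expanded by x^q y^q,
    lies in R_x or in R_y. Such a \<open>q\<close> may be enlarged, so a single \<open>q\<close>
    serves all of the finitely many terms of \<open>r\<close>.\<close>
  have mono: "?F u (q + l)" if F: "?F u q" for u q l
  proof -
    have split: "Y (p + (q + l)) = Y (p + q) + Y l" "X (p + (q + l)) = X (p + q) + X l"
      "X (q + l) + Y (q + l) + u = (X q + Y q + u) + (X l + Y l)"
      using Y_add[of "p + q" l] X_add[of "p + q" l] by (simp_all add: X_add Y_add ac_simps)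
    from F consider s where "s \<in> S" "X q + Y q + u = Y (p + q) + s" | s where "s \<in> S" "X q + Y q + u = X (p + q) + s"
      by auto
    then show ?thesis
    proof cases
      case 1
      then have "X (q + l) + Y (q + l) + u = Y (p + (q + l)) + (X l + s)"
        unfolding split by (simp add: ac_simps)
      then show ?thesis using 1(1) by (auto intro: add_mem X_mem)
    next
      case 2
      then have "X (q + l) + Y (q + l) + u = X (p + (q + l)) + (Y l + s)"
        unfolding split by (simp add: ac_simps)
      then show ?thesis using 2(1) by (auto intro: add_mem Y_mem)
    qed
  qed
  have "\<exists>q. \<forall>u\<in>A. ?F u q" if "finite A" "A \<subseteq> Poly_Mapping.keys r" for A
    using that
  proof (induction A)
    case (insert u A)
    then obtain q where q: "\<forall>u\<in>A. ?F u q" by auto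
    have "u \<in> S" "deg u = of_int n + 2 * real p"
      using insert.prems r(1) by (auto simp: R_simps)
    then obtain q' where "?F u q'" using fraction by blast
    then have "\<forall>v\<in>insert u A. ?F v (q + q')"
      using q mono[of q _ q'] mono[of q' u q] by (simp add: add.commute)
    then show ?case by blast
  qed simp
  then obtain q where q: "\<forall>u\<in>Poly_Mapping.keys r. ?F u q" using finite_keys by blast
  define P where "P = p + q"
  have qP: "q + p = P" "p + q = P" by (simp_all add: P_def)
  have keys_xyr: "Poly_Mapping.keys (x q * (y q * r)) = (\<lambda>u. X q + (Y q + u)) ` Poly_Mapping.keys r"
    by (simp add: x_def y_def keys_single_times image_image)
  then have "Poly_Mapping.keys (x q * (y q * r)) \<subseteq> (+) (Y P) ` S \<union> (+) (X P) ` S"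
    using q by (auto simp: P_def add.assoc)
  \<comment> \<open>With \<open>P = p + q\<close> this reads r / (x^p y^p) = g / x^P + h /
    y^P.\<close>
  then obtain g h where gh: "Poly_Mapping.keys g \<subseteq> S" "Poly_Mapping.keys h \<subseteq> S"
    "(+) (Y P) ` Poly_Mapping.keys g \<subseteq> Poly_Mapping.keys (x q * (y q * r))"
    "(+) (X P) ` Poly_Mapping.keys h \<subseteq> Poly_Mapping.keys (x q * (y q * r))"
    "x q * (y q * r) = y P * g + x P * h"
    unfolding y_def[of P] x_def[of P] by (rule two_singles_times_exist)
  have deg_xyr: "deg u = n + 2 * P" if "u \<in> Poly_Mapping.keys (x q * (y q * r))" for u
    using that r(1) by (auto simp: keys_xyr R_simps deg_add deg_X deg_Y P_def)
  have "deg u = of_int (n + P)" if "u \<in> Poly_Mapping.keys g" for u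
    using deg_xyr[of "Y P + u"] gh(3) that by (auto simp: deg_add deg_Y)
  moreover have "deg u = of_int (n + P)" if "u \<in> Poly_Mapping.keys h" for u
    using deg_xyr[of "X P + u"] gh(4) that by (auto simp: deg_add deg_X)
  ultimately have g: "- g \<in> ring_comp R (n + P)" "- g \<in> carrier R" "g \<in> carrier R"
    and h: "h \<in> ring_comp R (n + P)" "h \<in> carrier R"
    using gh(1,2) by (auto simp: R_simps)
  \<comment> \<open>Correcting the lifts by \<open>g\<close> and \<open>h\<close> absorbs the
    obstruction \<open>r\<close>: now y^P vx' = x^P vy'. Since \<open>\<delta> 0\<close> kills the
    image of \<open>\<epsilon>\<close>, the corrected lifts still map to x^P w and y^P w.\<close>
  define vx' where "vx' = x q \<odot>\<^bsub>I 0\<^esub> vx \<oplus>\<^bsub>I 0\<^esub> \<epsilon> (- g)"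
  define vy' where "vy' = y q \<odot>\<^bsub>I 0\<^esub> vy \<oplus>\<^bsub>I 0\<^esub> \<epsilon> h"
  have vx': "vx' \<in> mod_comp (I 0) (n + P)"
    unfolding vx'_def using xy_comp(1)[OF graded_I vx(1), of q] \<epsilon>(4)[OF g(2,1)]
    by (intro is_graded_module_comp(3)[OF graded_I]) (simp_all add: P_def add.assoc)
  have vy': "vy' \<in> mod_comp (I 0) (n + P)"
    unfolding vy'_def using xy_comp(2)[OF graded_I vy(1), of q] \<epsilon>(4)[OF h(2,1)]
    by (intro is_graded_module_comp(3)[OF graded_I]) (simp_all add: P_def add.assoc)
  note mem = xy_mem(1,2) times_mem plus_mem
  have yvx: "y p \<odot>\<^bsub>I 0\<^esub> vx = x p \<odot>\<^bsub>I 0\<^esub> vy \<oplus>\<^bsub>I 0\<^esub> \<epsilon> r"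
    unfolding r(2) using vxc vyc by (simp add: mem minus_add_cancel)
  have "y P \<odot>\<^bsub>I 0\<^esub> (x q \<odot>\<^bsub>I 0\<^esub> vx) = x q \<odot>\<^bsub>I 0\<^esub> (y q \<odot>\<^bsub>I 0\<^esub> (y p \<odot>\<^bsub>I 0\<^esub> vx))"
    using vxc by (simp add: xy_smult[OF graded_I] mem qP)
  also have "\<dots> = x P \<odot>\<^bsub>I 0\<^esub> (y q \<odot>\<^bsub>I 0\<^esub> vy) \<oplus>\<^bsub>I 0\<^esub> \<epsilon> (y P * g + x P * h)"
    using vyc rc by (simp add: yvx I.smult_r_distr xy_smult[OF graded_I] mem qP \<epsilon>(1,3) flip: gh(5))
  finally have "y P \<odot>\<^bsub>I 0\<^esub> vx' = x P \<odot>\<^bsub>I 0\<^esub> (y q \<odot>\<^bsub>I 0\<^esub> vy) \<oplus>\<^bsub>I 0\<^esub> \<epsilon> (y P * g + x P * h) \<oplus>\<^bsub>I 0\<^esub> \<epsilon> (y P * (- g))"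
    unfolding vx'_def using vxc g by (simp add: I.smult_r_distr mem \<epsilon>(1,3) del: mult_minus_right)
  also have "\<dots> = x P \<odot>\<^bsub>I 0\<^esub> (y q \<odot>\<^bsub>I 0\<^esub> vy) \<oplus>\<^bsub>I 0\<^esub> \<epsilon> (y P * g + x P * h + y P * (- g))"
    using vyc g h by (subst \<epsilon>(2)[of "y P * g + x P * h"]) (simp_all add: mem \<epsilon>(1) I.M.a_assoc del: mult_minus_right)
  also have "\<dots> = x P \<odot>\<^bsub>I 0\<^esub> vy'"
    unfolding vy'_def using vyc h by (simp add: I.smult_r_distr mem \<epsilon>(1,3))
  finally obtain v where v: "v \<in> mod_comp (I 0) n"
    "x (P + c) \<odot>\<^bsub>I 0\<^esub> v = x c \<odot>\<^bsub>I 0\<^esub> vx'" "y (P + c) \<odot>\<^bsub>I 0\<^esub> v = y c \<odot>\<^bsub>I 0\<^esub> vy'"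
    using common_quotient[OF inj_\<epsilon> injective vx' vy'] by blast
  note vc = comp_carrier[OF v(1)]
  have "\<delta> 0 vx' = x P \<odot>\<^bsub>I 1\<^esub> w" "\<delta> 0 vy' = y P \<odot>\<^bsub>I 1\<^esub> w"
    unfolding vx'_def vy'_def using vxc vyc vx(2) vy(2) wc g h
    by (simp_all add: \<delta>(2,4) \<epsilon>(1,5) mem xy_smult[OF graded_I] qP)
  then have "x (P + c) \<odot>\<^bsub>I 1\<^esub> \<delta> 0 v = x (P + c) \<odot>\<^bsub>I 1\<^esub> w" "y (P + c) \<odot>\<^bsub>I 1\<^esub> \<delta> 0 v = y (P + c) \<odot>\<^bsub>I 1\<^esub> w"
    using \<delta>(4)[OF vc, of "x (P + c)"] \<delta>(4)[OF vc, of "y (P + c)"] v(2,3)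
      \<delta>(4)[OF comp_carrier[OF vx'], of "x c"] \<delta>(4)[OF comp_carrier[OF vy'], of "y c"] wc
    by (simp_all add: mem xy_smult[OF graded_I] add.commute)
  \<comment> \<open>The common quotient \<open>v\<close> has an image agreeing with \<open>w\<close>
    after multiplication by x^(P+c) and by y^(P+c). The difference is thus torsion, and
    \<open>\<delta> 1\<close> still sends it to \<open>z\<close>.\<close>
  then have "w \<ominus>\<^bsub>I 1\<^esub> \<delta> 0 v \<in> torsion R J (I 1)"
    using wc vc \<delta>(1)[OF vc]
    by (auto simp: torsion_iff[OF graded_I] smult_minus[OF graded_I] mem minus_self intro!: exI[of _ "P + c"])
  moreover have "\<delta> 1 (w \<ominus>\<^bsub>I 1\<^esub> \<delta> 0 v) = z"
    using wc \<delta>(1)[OF vc] \<delta>(6)[OF vc] w(2) z2(1) comp_carrier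
    by (simp add: \<delta>(3) minus_zero)
  ultimately show ?thesis
    by (auto simp: coboundaries_def numeral_2_eq_2)
qed

text \<open>The class of u / (x^p y^p) is built by reversing the chase: \<open>vx\<close> is chosen
  with y^p vx equal to the image of the monomial \<open>u\<close>, and 0 serves as the second lift.
  A common quotient \<open>w\<close> of their images in \<open>I 1\<close> gives the cocycle
  \<open>\<delta> 1 w\<close>. Were it a coboundary, the fraction would split into an element of R_x
  plus an element of R_y.\<close>

lemma exists_nontrivial_cocycle:
  assumes u: "u \<in> S" "deg u = of_int n + 2 * real p"
    and fraction: "\<And>q. X q + Y q + u \<notin> (+) (Y (p + q)) ` S \<union> (+) (X (p + q)) ` S"
  obtains z where "z \<in> cocycles R J I \<delta> 2" "z \<in> mod_comp (I 2) n" "z \<notin> coboundaries R J I \<delta> 2"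
proof -
  note mem = xy_mem(1,2) times_mem plus_mem
  define r where "r = Poly_Mapping.single u (1::'k)"
  have r: "r \<in> carrier R" "r \<in> ring_comp R (n + p + p)"
    using u by (simp_all add: r_def R_simps)
  obtain vx where vx: "vx \<in> mod_comp (I 0) (n + p)" "y p \<odot>\<^bsub>I 0\<^esub> vx = \<epsilon> r"
    by (rule y_divisible[OF inj_\<epsilon> injective \<epsilon>(4)[OF r]])
  note vxc = comp_carrier[OF vx(1)]
  \<comment> \<open>The pair consisting of \<open>\<delta> 0 vx\<close> and 0 satisfies the
    hypothesis of \<open>common_quotient\<close>, because y^p vx comes from the ring.\<close>
  have "y p \<odot>\<^bsub>I 1\<^esub> \<delta> 0 vx = \<delta> 0 (y p \<odot>\<^bsub>I 0\<^esub> vx)"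
    by (simp add: \<delta>(4)[OF vxc] mem)
  also have "\<dots> = x p \<odot>\<^bsub>I 1\<^esub> \<zero>\<^bsub>I 1\<^esub>"
    using \<epsilon>(5)[OF r(1)] by (simp add: vx(2) mem)
  finally have "y p \<odot>\<^bsub>I 1\<^esub> \<delta> 0 vx = x p \<odot>\<^bsub>I 1\<^esub> \<zero>\<^bsub>I 1\<^esub>" .
  moreover have "\<delta> 0 vx \<in> mod_comp (I 1) (n + p)" "\<zero>\<^bsub>I 1\<^esub> \<in> mod_comp (I 1) (n + p)"
    using \<delta>(5)[OF vxc vx(1)] is_graded_module_comp(2)[OF graded_I] by auto
  ultimately obtain w where w: "w \<in> mod_comp (I 1) n" "x (p + c) \<odot>\<^bsub>I 1\<^esub> w = x c \<odot>\<^bsub>I 1\<^esub> \<delta> 0 vx"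
    "y (p + c) \<odot>\<^bsub>I 1\<^esub> w = \<zero>\<^bsub>I 1\<^esub>"
    using common_quotient[OF inj_\<epsilon> injective, of "\<delta> 0 vx" 1 n p "\<zero>\<^bsub>I 1\<^esub>"] by (auto simp: mem)
  note wc = comp_carrier[OF w(1)]
  have "x (p + c) \<odot>\<^bsub>I (Suc 1)\<^esub> \<delta> 1 w = \<zero>\<^bsub>I (Suc 1)\<^esub>" "y (p + c) \<odot>\<^bsub>I (Suc 1)\<^esub> \<delta> 1 w = \<zero>\<^bsub>I (Suc 1)\<^esub>"
    using \<delta>(4)[OF wc, of "x (p + c)"] \<delta>(4)[OF wc, of "y (p + c)"] \<delta>(1,6)[OF vxc] \<delta>(4)[of "\<delta> 0 vx" 1 "x c"]
      graded_hom_minus(1)[OF I.module_axioms I.module_axioms hom_\<delta>, of 1] w(2,3)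
    by (simp_all add: mem)
  then have "\<delta> 1 w \<in> cocycles R J I \<delta> 2"
    using \<delta>(1,6)[OF wc] by (auto simp: cocycles_def torsion_iff[OF graded_I] numeral_2_eq_2)
  moreover have "\<delta> 1 w \<in> mod_comp (I 2) n"
    using \<delta>(5)[OF wc w(1)] by (simp add: numeral_2_eq_2)
  moreover have "\<delta> 1 w \<notin> coboundaries R J I \<delta> 2"
  proof
    assume "\<delta> 1 w \<in> coboundaries R J I \<delta> 2"
    then obtain w' where "w' \<in> torsion R J (I 1)" and dw': "\<delta> 1 w = \<delta> 1 w'"
      by (auto simp: coboundaries_def numeral_2_eq_2)
    then obtain m where w': "w' \<in> carrier (I 1)" "x m \<odot>\<^bsub>I 1\<^esub> w' = \<zero>\<^bsub>I 1\<^esub>" "y m \<odot>\<^bsub>I 1\<^esub> w' = \<zero>\<^bsub>I 1\<^esub>"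
      using torsion_iff[OF graded_I] by auto
    \<comment> \<open>Subtracting the torsion element \<open>w'\<close> turns \<open>w\<close> into
      a cocycle, which lifts to \<open>v\<close>.\<close>
    have "\<delta> 1 (w \<ominus>\<^bsub>I 1\<^esub> w') = \<zero>\<^bsub>I (Suc 1)\<^esub>"
      using \<delta>(1)[OF w'(1)] wc w'(1) dw' by (simp add: \<delta>(3) minus_self)
    then obtain v where v: "v \<in> carrier (I 0)" "\<delta> 0 v = w \<ominus>\<^bsub>I 1\<^esub> w'"
      using exact_\<delta>D[of "w \<ominus>\<^bsub>I 1\<^esub> w'" 0] I.M.minus_closed[OF wc w'(1)] by auto
    \<comment> \<open>With this \<open>q\<close> the exponent \<open>M\<close> equals m + p + c: it
      is large enough for x^M and y^M to annihilate \<open>w'\<close>, while x^M w = x^q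
      \<open>\<delta> 0 vx\<close> and y^M w = 0.\<close>
    define q where "q = m + c"
    define M where "M = p + q"
    have M: "m + (p + c) = M" "(p + c) + m = M" "q + p = M" by (simp_all add: M_def q_def)
    have "x M \<odot>\<^bsub>I 1\<^esub> w' = \<zero>\<^bsub>I 1\<^esub>" "y M \<odot>\<^bsub>I 1\<^esub> w' = \<zero>\<^bsub>I 1\<^esub>"
      using w' xy_smult(1,2)[OF graded_I w'(1), of "p + c" m, symmetric] by (simp_all add: M mem)
    moreover have "x M \<odot>\<^bsub>I 1\<^esub> w = x q \<odot>\<^bsub>I 1\<^esub> \<delta> 0 vx" "y M \<odot>\<^bsub>I 1\<^esub> w = \<zero>\<^bsub>I 1\<^esub>"
      using xy_smult(1,2)[OF graded_I wc, of m "p + c", symmetric] w(2,3) \<delta>(1)[OF vxc]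
      by (simp_all add: M mem xy_smult[OF graded_I] q_def)
    ultimately have dv: "\<delta> 0 (x M \<odot>\<^bsub>I 0\<^esub> v) = \<delta> 0 (x q \<odot>\<^bsub>I 0\<^esub> vx)" "\<delta> 0 (y M \<odot>\<^bsub>I 0\<^esub> v) = \<zero>\<^bsub>I 1\<^esub>"
      using v vxc wc w'(1) \<delta>(1)[OF vxc] by (simp_all add: \<delta>(4) mem smult_minus[OF graded_I] minus_zero)
    \<comment> \<open>Exactness at \<open>I 0\<close> produces ring elements: \<open>r1\<close> from
      x^q vx - x^M v, and \<open>r2\<close> from y^M v.\<close>
    then have "\<delta> 0 (x q \<odot>\<^bsub>I 0\<^esub> vx \<ominus>\<^bsub>I 0\<^esub> x M \<odot>\<^bsub>I 0\<^esub> v) = \<zero>\<^bsub>I 1\<^esub>"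
      using v vxc \<delta>(1)[of "x q \<odot>\<^bsub>I 0\<^esub> vx" 0] by (simp add: \<delta>(3) mem minus_self)
    then obtain r1 where r1: "r1 \<in> carrier R" "\<epsilon> r1 = x q \<odot>\<^bsub>I 0\<^esub> vx \<ominus>\<^bsub>I 0\<^esub> x M \<odot>\<^bsub>I 0\<^esub> v"
      using exact_\<epsilon>D[of "x q \<odot>\<^bsub>I 0\<^esub> vx \<ominus>\<^bsub>I 0\<^esub> x M \<odot>\<^bsub>I 0\<^esub> v"] v(1) vxc
      by (auto simp: mem I.M.minus_closed)
    obtain r2 where r2: "r2 \<in> carrier R" "\<epsilon> r2 = y M \<odot>\<^bsub>I 0\<^esub> v"
      using exact_\<epsilon>D[of "y M \<odot>\<^bsub>I 0\<^esub> v"] v(1) dv(2) by (auto simp: mem)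
    have "y M \<odot>\<^bsub>I 0\<^esub> (x q \<odot>\<^bsub>I 0\<^esub> vx) = x q \<odot>\<^bsub>I 0\<^esub> (y q \<odot>\<^bsub>I 0\<^esub> (y p \<odot>\<^bsub>I 0\<^esub> vx))"
      using vxc by (simp add: xy_smult[OF graded_I] mem M)
    also have "\<dots> = \<epsilon> (x q * (y q * r))"
      using r(1) by (simp add: vx(2) \<epsilon>(3) mem)
    finally have yx: "y M \<odot>\<^bsub>I 0\<^esub> (x q \<odot>\<^bsub>I 0\<^esub> vx) = \<epsilon> (x q * (y q * r))" .
    have "x q \<odot>\<^bsub>I 0\<^esub> vx = \<epsilon> r1 \<oplus>\<^bsub>I 0\<^esub> x M \<odot>\<^bsub>I 0\<^esub> v"
      using v(1) vxc by (simp add: r1(2) mem minus_add_cancel)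
    then have "\<epsilon> (x q * (y q * r)) = y M \<odot>\<^bsub>I 0\<^esub> (\<epsilon> r1 \<oplus>\<^bsub>I 0\<^esub> x M \<odot>\<^bsub>I 0\<^esub> v)"
      using yx by simp
    also have "\<dots> = y M \<odot>\<^bsub>I 0\<^esub> \<epsilon> r1 \<oplus>\<^bsub>I 0\<^esub> x M \<odot>\<^bsub>I 0\<^esub> \<epsilon> r2"
      using v(1) r1(1) by (simp add: I.smult_r_distr mem \<epsilon>(1) xy_smult[OF graded_I] r2(2))
    also have "\<dots> = \<epsilon> (y M * r1 + x M * r2)"
      using r1(1) r2(1) by (simp add: \<epsilon>(2,3) mem)
    \<comment> \<open>Injectivity of \<open>\<epsilon>\<close> brings the equation back to the ring.
      The single monomial on the left must then occur in one of the two products, contradicting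
      \<open>fraction\<close>.\<close>
    finally have "x q * (y q * r) = y M * r1 + x M * r2"
      using inj_\<epsilon> r(1) r1(1) r2(1) by (simp add: inj_on_eq_iff mem)
    moreover have "X q + Y q + u \<in> Poly_Mapping.keys (x q * (y q * r))"
      by (simp add: x_def y_def r_def keys_single_times add.assoc)
    ultimately have "X q + Y q + u \<in> Poly_Mapping.keys (y M * r1) \<union> Poly_Mapping.keys (x M * r2)"
      using keys_add[of "y M * r1" "x M * r2"] by auto
    then have "X q + Y q + u \<in> (+) (Y M) ` S \<union> (+) (X M) ` S"
      using r1(1) r2(1) by (auto simp: x_def y_def keys_single_times R_simps)
    then show False using fraction[of q] by (simp add: M_def)
  qed
  ultimately show thesis by (rule that)
qed

section \<open>Graded components of the cohomology and the a-invariant\<close>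

lemma torsion_minus:
  assumes "v \<in> torsion R J (I j)" "w \<in> torsion R J (I j)"
  shows "v \<ominus>\<^bsub>I j\<^esub> w \<in> torsion R J (I j)"
proof -
  obtain p q where p: "v \<in> carrier (I j)" "x p \<odot>\<^bsub>I j\<^esub> v = \<zero>\<^bsub>I j\<^esub>" "y p \<odot>\<^bsub>I j\<^esub> v = \<zero>\<^bsub>I j\<^esub>"
    and q: "w \<in> carrier (I j)" "x q \<odot>\<^bsub>I j\<^esub> w = \<zero>\<^bsub>I j\<^esub>" "y q \<odot>\<^bsub>I j\<^esub> w = \<zero>\<^bsub>I j\<^esub>"
    using assms torsion_iff[OF graded_I] by auto
  have "x (p + q) \<odot>\<^bsub>I j\<^esub> v = \<zero>\<^bsub>I j\<^esub>" "y (p + q) \<odot>\<^bsub>I j\<^esub> v = \<zero>\<^bsub>I j\<^esub>"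
    using xy_smult(1,2)[OF graded_I p(1), of q p, symmetric] by (simp_all add: p xy_mem add.commute)
  moreover have "x (p + q) \<odot>\<^bsub>I j\<^esub> w = \<zero>\<^bsub>I j\<^esub>" "y (p + q) \<odot>\<^bsub>I j\<^esub> w = \<zero>\<^bsub>I j\<^esub>"
    using xy_smult(1,2)[OF graded_I q(1), of p q, symmetric] by (simp_all add: q xy_mem)
  ultimately show ?thesis
    using p(1) q(1) I.M.minus_closed
    by (auto simp: torsion_iff[OF graded_I] smult_minus[OF graded_I] xy_mem minus_self intro!: exI[of _ "p + q"])
qed

text \<open>The unit of the quotient is the set of coboundaries itself. As this set is closed under
  subtraction, a coset equals it iff its representative is a coboundary. The zero cocycle shows that
  the component is never empty.\<close>

lemma trivial_comp_iff:
  "local_cohomology_comp R J I \<delta> 2 n = {\<one>\<^bsub>local_cohomology R J I \<delta> 2\<^esub>} \<longleftrightarrow>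
    cocycles R J I \<delta> 2 \<inter> mod_comp (I 2) n \<subseteq> coboundaries R J I \<delta> 2"
proof -
  let ?B = "coboundaries R J I \<delta> 2"
  have B: "?B = \<delta> 1 ` torsion R J (I 1)" by (simp add: coboundaries_def numeral_2_eq_2)
  have zero_torsion: "\<zero>\<^bsub>I j\<^esub> \<in> torsion R J (I j)" for j
    by (auto simp: torsion_iff[OF graded_I] xy_mem)
  have tc: "v \<in> carrier (I j)" if "v \<in> torsion R J (I j)" for v j
    using that by (simp add: torsion_def)
  have Bc: "b \<in> carrier (I 2)" if b: "b \<in> ?B" for b
  proof -
    obtain v where "v \<in> torsion R J (I 1)" "b = \<delta> 1 v" using b by (auto simp: B)
    then show ?thesis using \<delta>(1)[OF tc] by (simp add: numeral_2_eq_2)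
  qed
  have B_minus: "b \<ominus>\<^bsub>I 2\<^esub> z \<in> ?B" if b: "b \<in> ?B" and z: "z \<in> ?B" for b z
  proof -
    obtain v w where vw: "v \<in> torsion R J (I 1)" "b = \<delta> 1 v" "w \<in> torsion R J (I 1)" "z = \<delta> 1 w"
      using b z by (auto simp: B)
    then have "b \<ominus>\<^bsub>I 2\<^esub> z = \<delta> 1 (v \<ominus>\<^bsub>I 1\<^esub> w)"
      using \<delta>(3)[OF tc tc] by (simp add: numeral_2_eq_2)
    then show ?thesis
      unfolding B using torsion_minus[OF vw(1,3)] by (rule image_eqI)
  qed
  have B_zero: "\<zero>\<^bsub>I 2\<^esub> \<in> ?B"
  proof -
    have "\<delta> 1 \<zero>\<^bsub>I 1\<^esub> = \<zero>\<^bsub>I 2\<^esub>"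
      using graded_hom_minus(1)[OF I.module_axioms I.module_axioms hom_\<delta>, of 1] by (simp add: numeral_2_eq_2)
    then show ?thesis unfolding B using zero_torsion[of 1] by (metis imageI)
  qed
  have B_add: "b \<oplus>\<^bsub>I 2\<^esub> z \<in> ?B" if b: "b \<in> ?B" and z: "z \<in> ?B" for b z
    using B_minus[OF b B_minus[OF B_zero z]] Bc[OF b] Bc[OF z] by (simp add: a_minus_def)
  have coset: "?B +>\<^bsub>I 2\<^esub> z = ?B \<longleftrightarrow> z \<in> ?B" if z: "z \<in> carrier (I 2)" for z
  proof
    assume "?B +>\<^bsub>I 2\<^esub> z = ?B"
    moreover have "z \<in> ?B +>\<^bsub>I 2\<^esub> z"
      using B_zero z unfolding a_r_coset_def' by (auto intro!: bexI[of _ "\<zero>\<^bsub>I 2\<^esub>"])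
    ultimately show "z \<in> ?B" by simp
  next
    assume zB: "z \<in> ?B"
    show "?B +>\<^bsub>I 2\<^esub> z = ?B"
    proof
      show "?B +>\<^bsub>I 2\<^esub> z \<subseteq> ?B" unfolding a_r_coset_def' using B_add zB by auto
      show "?B \<subseteq> ?B +>\<^bsub>I 2\<^esub> z"
      proof
        fix b assume b: "b \<in> ?B"
        then have "b = (b \<ominus>\<^bsub>I 2\<^esub> z) \<oplus>\<^bsub>I 2\<^esub> z" using minus_add_cancel(1) Bc z by simp
        then show "b \<in> ?B +>\<^bsub>I 2\<^esub> z"
          unfolding a_r_coset_def' using B_minus[OF b zB] by auto
      qed
    qed
  qed
  have zero: "\<zero>\<^bsub>I 2\<^esub> \<in> cocycles R J I \<delta> 2 \<inter> mod_comp (I 2) n"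
    using zero_torsion[of 2] graded_hom_minus(1)[OF I.module_axioms I.module_axioms hom_\<delta>]
      is_graded_module_comp(2)[OF graded_I] by (simp add: cocycles_def)
  have image_eq: "f ` A = {b} \<longleftrightarrow> (\<forall>a \<in> A. f a = b)" if "z \<in> A" for f :: "'m \<Rightarrow> 'm set" and A b z
    using that by blast
  have "local_cohomology_comp R J I \<delta> 2 n = {?B} \<longleftrightarrow>
      (\<forall>z \<in> cocycles R J I \<delta> 2 \<inter> mod_comp (I 2) n. ?B +>\<^bsub>I 2\<^esub> z = ?B)"
    unfolding local_cohomology_comp_def by (rule image_eq[OF zero])
  also have "\<dots> \<longleftrightarrow> (\<forall>z \<in> cocycles R J I \<delta> 2 \<inter> mod_comp (I 2) n. z \<in> ?B)"
    by (intro ball_cong refl coset comp_carrier[of _ 2 n]) simp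
  also have "\<dots> \<longleftrightarrow> cocycles R J I \<delta> 2 \<inter> mod_comp (I 2) n \<subseteq> ?B"
    by blast
  finally show ?thesis
    by (simp add: local_cohomology_def A_FactGroup_def FactGroup_def)
qed

text \<open>The first hypothesis makes every cocycle of degree above \<open>N\<close> a coboundary;
  the others exhibit a nonzero class in degree \<open>N\<close>, so the supremum is
  attained.\<close>

lemma a_invariant_eqI:
  assumes "\<And>n p u. N < n \<Longrightarrow> u \<in> S \<Longrightarrow> deg u = of_int n + 2 * real p \<Longrightarrow>
      \<exists>q. X q + Y q + u \<in> (+) (Y (p + q)) ` S \<union> (+) (X (p + q)) ` S"
    and "u \<in> S" "deg u = of_int N + 2 * real p"
    and "\<And>q. X q + Y q + u \<notin> (+) (Y (p + q)) ` S \<union> (+) (X (p + q)) ` S"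
  shows "a_invariant R J I \<delta> 2 = ereal (of_int N)"
proof -
  have "\<not> cocycles R J I \<delta> 2 \<inter> mod_comp (I 2) N \<subseteq> coboundaries R J I \<delta> 2"
    using exists_nontrivial_cocycle[OF assms(2-4)] by blast
  moreover have "n \<le> N" if "\<not> cocycles R J I \<delta> 2 \<inter> mod_comp (I 2) n \<subseteq> coboundaries R J I \<delta> 2" for n
  proof (rule ccontr)
    assume "\<not> n \<le> N"
    then show False using that cocycle_is_coboundary[of _ n] assms(1)[of n] by auto
  qed
  ultimately show ?thesis
    unfolding a_invariant_def trivial_comp_iff
  proof (intro Sup_eqI)
    fix y assume y: "y \<in> {ereal (real_of_int n) |n. \<not> cocycles R J I \<delta> 2 \<inter> mod_comp (I 2) n \<subseteq> coboundaries R J I \<delta> 2}"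
      and le: "\<And>n. \<not> cocycles R J I \<delta> 2 \<inter> mod_comp (I 2) n \<subseteq> coboundaries R J I \<delta> 2 \<Longrightarrow> n \<le> N"
    then show "y \<le> ereal (real_of_int N)" by force
  qed blast
qed

end

section \<open>Projective monomial curves\<close>

lemma submonoid_generated_incl: "u \<in> A \<Longrightarrow> u \<in> submonoid_generated A"
  using submonoid_generated.add[OF _ submonoid_generated.zero, of u A] by simp

lemma submonoid_generated_plus:
  "u \<in> submonoid_generated A \<Longrightarrow> v \<in> submonoid_generated A \<Longrightarrow> u + v \<in> submonoid_generated A"
  by (induction rule: submonoid_generated.induct) (auto simp: add.assoc intro: submonoid_generated.add)

lemma submonoid_generated_mono: "u \<in> submonoid_generated A \<Longrightarrow> A \<subseteq> B \<Longrightarrow> u \<in> submonoid_generated B"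
  by (induction rule: submonoid_generated.induct) (auto intro: submonoid_generated.intros)

lemma submonoid_generated_times: "(u::nat) \<in> submonoid_generated A \<Longrightarrow> n * u \<in> submonoid_generated A"
  by (induction n) (auto intro: submonoid_generated.zero submonoid_generated_plus)

text \<open>A Bezout identity involves a negative coefficient, which has no place in a monoid;
  modulo \<open>d\<close> the coefficient -n is replaced by \<open>(d - 1) * n\<close>.\<close>

lemma submonoid_generated_Gcd_cong:
  fixes A :: "nat set"
  assumes "finite A" "d > 0"
  shows "\<exists>s \<in> submonoid_generated A. [s = Gcd A] (mod d)"
  using assms(1)
proof (induction A)
  case empty
  then show ?case using submonoid_generated.zero by force
next
  case (insert a A)
  then obtain s where s: "s \<in> submonoid_generated A" "[s = Gcd A] (mod d)" by blast
  note s' = submonoid_generated_mono[OF s(1) subset_insertI[of A a]]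
  show ?case
  proof (cases "a = 0")
    case True
    then show ?thesis using s s' by auto
  next
    case False
    obtain m n where mn: "a * m = Gcd A * n + gcd a (Gcd A)"
      using bezout_nat[OF False, of "Gcd A"] by blast
    let ?t = "m * a + ((d - 1) * n) * s"
    have "[?t = m * a + ((d - 1) * n) * Gcd A] (mod d)"
      by (intro cong_add cong_mult cong_refl s(2))
    also have "m * a + ((d - 1) * n) * Gcd A = gcd a (Gcd A) + d * (n * Gcd A)"
      using mn \<open>d > 0\<close> by (cases d) (simp_all add: algebra_simps)
    also have "[\<dots> = gcd a (Gcd A)] (mod d)" by (simp add: cong_def)
    finally have "[?t = Gcd (insert a A)] (mod d)" by simp
    moreover have "?t \<in> submonoid_generated (insert a A)"
      by (intro submonoid_generated_plus submonoid_generated_times s' submonoid_generated_incl) simp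
    ultimately show ?thesis by blast
  qed
qed

lemma cong_le_multiple:
  fixes m n d :: nat
  assumes "[m = n] (mod d)" "m \<le> n"
  obtains i where "n = m + i * d"
  using assms that by (metis add.commute cong_le_nat cong_sym)

section \<open>Saturation of plane monoids along both axes\<close>

locale curve_cone =
  fixes S :: "(nat \<times> nat) set" and d :: nat
  assumes zero_in: "(0, 0) \<in> S" and add_in: "s \<in> S \<Longrightarrow> t \<in> S \<Longrightarrow> s + t \<in> S"
    and axis_in: "(0, d) \<in> S" "(d, 0) \<in> S" and d_pos: "d > 0"
    and dvd_sum: "(u, v) \<in> S \<Longrightarrow> d dvd u + v"
    and residue: "\<exists>u \<in> fst ` S. [u = j] (mod d)"
begin

lemma multiples_in: "(0, n * d) \<in> S" "(n * d, 0) \<in> S"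
proof (induction n)
  case (Suc n)
  show "(0, Suc n * d) \<in> S" "(Suc n * d, 0) \<in> S"
    using add_in[OF axis_in(1) Suc(1)] add_in[OF axis_in(2) Suc(2)] by simp_all
qed (simp_all add: zero_in)

lemma shift_in: "(u, v) \<in> S \<Longrightarrow> (u + m * d, v + n * d) \<in> S"
  using add_in[OF add_in[OF _ multiples_in(2)[of m]] multiples_in(1)[of n], of "(u, v)"] by simp

text \<open>Since \<open>d\<close> divides \<open>u + v\<close>, the coordinates of a point have
  opposite residues. A first coordinate in the class of -j, written \<open>(d - 1) * j\<close>, is
  thus accompanied by a second one in the class of \<open>j\<close>. Results on one coordinate
  transfer to the other by this symmetry.\<close>

lemma curve_cone_swap: "curve_cone (prod.swap ` S) d"
proof
  show "\<exists>u \<in> fst ` prod.swap ` S. [u = j] (mod d)" for j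
  proof -
    obtain u v where uv: "(u, v) \<in> S" "[u = (d - 1) * j] (mod d)"
      using residue[of "(d - 1) * j"] by auto
    have "[v + u = j + u] (mod d)"
    proof -
      have "[j + u = j + (d - 1) * j] (mod d)" using uv(2) by (intro cong_add) auto
      also have "j + (d - 1) * j = d * j" using d_pos by (cases d) auto
      also have "[\<dots> = v + u] (mod d)"
        using dvd_sum[OF uv(1)] by (auto simp: cong_def add.commute mod_eq_0_iff_dvd)
      finally show ?thesis by (rule cong_sym)
    qed
    then have "[v = j] (mod d)" by (simp add: cong_add_rcancel_nat)
    then show ?thesis using uv(1) by (force simp: image_iff)
  qed
next
  show "d dvd u + v" if "(u, v) \<in> prod.swap ` S" for u v
    using dvd_sum[of v u] that by (auto simp: add.commute)
qed (use zero_in axis_in d_pos add_in in auto)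

text \<open>Each residue class has a least first coordinate \<open>\<alpha> j\<close>, paired with
  some second coordinate \<open>f j\<close>. Every \<open>u\<close> in the projection arises from it
  by adding multiples of \<open>d\<close>, and so does \<open>v + m * d\<close> from
  \<open>f j\<close> once \<open>m\<close> is large. Both shifts stay in \<open>S\<close> because it
  contains the axis points. The sum of the \<open>f j\<close> over all residues serves as a common
  bound.\<close>

lemma saturation: "\<exists>m0. \<forall>m \<ge> m0. \<forall>u \<in> fst ` S. \<forall>v. d dvd u + v \<longrightarrow> (u, v + m * d) \<in> S"
proof -
  define \<alpha> where "\<alpha> j = (LEAST u. u \<in> fst ` S \<and> [u = j] (mod d))" for j
  have \<alpha>: "\<alpha> j \<in> fst ` S" "[\<alpha> j = j] (mod d)" for j
    using LeastI_ex[of "\<lambda>u. u \<in> fst ` S \<and> [u = j] (mod d)"] residue[of j] by (auto simp: \<alpha>_def)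
  have "\<forall>j. \<exists>v. (\<alpha> j, v) \<in> S" using \<alpha>(1) by force
  then have "\<exists>f. \<forall>j. (\<alpha> j, f j) \<in> S" by (rule choice)
  then obtain f where f: "\<And>j. (\<alpha> j, f j) \<in> S" by blast
  have "(u, v + m * d) \<in> S" if m: "m \<ge> (\<Sum>j<d. f j)" and u: "u \<in> fst ` S" and v: "d dvd u + v" for m u v
  proof -
    let ?j = "u mod d"
    have \<alpha>_le: "\<alpha> ?j \<le> u" unfolding \<alpha>_def using u by (intro Least_le) simp
    have "[\<alpha> ?j = u] (mod d)" using \<alpha>(2)[of ?j] by simp
    then obtain i where i: "u = \<alpha> ?j + i * d" using \<alpha>_le by (rule cong_le_multiple)
    have "f ?j \<le> m"
      using member_le_sum[of ?j "{..<d}" f] d_pos m by simp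
    also have "m \<le> m * d" using d_pos by simp
    finally have le: "f ?j \<le> v + m * d" by simp
    have "[u + (v + m * d) = u + f ?j] (mod d)"
    proof -
      have "d dvd u + f ?j"
      proof -
        have "u + f ?j = (\<alpha> ?j + f ?j) + i * d" using i by linarith
        then show ?thesis using dvd_sum[OF f[of ?j]] by (metis dvd_add dvd_triv_right)
      qed
      moreover have "d dvd u + (v + m * d)" using dvd_add[OF v dvd_triv_right[of d m]] by (simp add: add.assoc)
      ultimately show ?thesis by (simp add: cong_def mod_eq_0_iff_dvd)
    qed
    then have "[f ?j = v + m * d] (mod d)" by (simp add: cong_add_lcancel_nat cong_sym_eq)
    then obtain l where "v + m * d = f ?j + l * d" using le by (rule cong_le_multiple)
    then show ?thesis using shift_in[OF f[of ?j], of i l] by (simp flip: i)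
  qed
  then show ?thesis by blast
qed

end

locale saturated_curve_cone = curve_cone +
  fixes c :: nat
  assumes saturated: "u \<in> fst ` S \<Longrightarrow> d dvd u + v \<Longrightarrow> (u, v + c * d) \<in> S"
    "v \<in> snd ` S \<Longrightarrow> d dvd u + v \<Longrightarrow> (u + c * d, v) \<in> S"

text \<open>\<open>saturation\<close> is applied to \<open>S\<close> and to its mirror image. Each
  bound persists for all larger multiples, so the maximum of the two works for both axes.\<close>

lemma (in curve_cone) saturated_curve_cone: "\<exists>c. saturated_curve_cone S d c"
proof -
  interpret swap: curve_cone "prod.swap ` S" d by (rule curve_cone_swap)
  obtain m where m: "\<forall>c \<ge> m. \<forall>u \<in> fst ` S. \<forall>v. d dvd u + v \<longrightarrow> (u, v + c * d) \<in> S"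
    using saturation by (rule exE)
  obtain n where n: "\<forall>c \<ge> n. \<forall>u \<in> fst ` prod.swap ` S. \<forall>v. d dvd u + v \<longrightarrow> (u, v + c * d) \<in> prod.swap ` S"
    using swap.saturation by (rule exE)
  have "saturated_curve_cone S d (max m n)"
  proof
    show "(u, v + max m n * d) \<in> S" if "u \<in> fst ` S" "d dvd u + v" for u v
      using m that max.cobounded1 by blast
    show "(u + max m n * d, v) \<in> S" if "v \<in> snd ` S" "d dvd u + v" for u v
    proof -
      have "v \<in> fst ` prod.swap ` S" using that(1) by (simp add: image_image)
      moreover have "d dvd v + u" using that(2) by (simp add: add.commute)
      ultimately have "(v, u + max m n * d) \<in> prod.swap ` S"
        using n max.cobounded2 by blast
      then show ?thesis by auto
    qed
  qed
  then show ?thesis by blast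
qed

context saturated_curve_cone
begin

lemma two_parameters:
  assumes "R = semigroup_ring (curve_deg d) S"
  shows "two_parameters S (curve_deg d) R (\<lambda>n. (0, n * d)) (\<lambda>n. (n * d, 0)) c"
proof
  show "R = semigroup_ring (curve_deg d) S" by fact
  show "0 \<in> S" using zero_in by (simp add: zero_prod_def)
  show "curve_deg d u \<in> \<int>" if "u \<in> S" for u
  proof -
    obtain e where "fst u + snd u = d * e" using dvd_sum[of "fst u" "snd u"] \<open>u \<in> S\<close> by (auto elim: dvdE)
    then have "curve_deg d u = real e" using d_pos by (simp add: curve_deg_def)
    then show ?thesis by simp
  qed
  show "1 \<le> curve_deg d u" if "u \<in> S" "u \<noteq> 0" for u
  proof -
    have "d \<le> fst u + snd u"
      using dvd_sum[of "fst u" "snd u"] that by (intro dvd_imp_le) (auto simp: prod_eq_iff)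
    then show ?thesis using d_pos by (simp add: curve_deg_def del: of_nat_add)
  qed
  show "(0, c * d) + u \<in> (+) (p * d, 0) ` S"
    if "u \<in> S" "v \<in> S" "(0, (p + c) * d) + u = ((p + c) * d, 0) + v" for u v p
  proof -
    obtain u1 u2 v1 v2 where uv: "u = (u1, u2)" "v = (v1, v2)" by (cases u, cases v)
    \<comment> \<open>Comparing first coordinates shows that dividing by y^p leaves
      \<open>v1 + c * d\<close>, which is again a first coordinate of \<open>S\<close>.
      Multiplication by x^c supplies the \<open>c * d\<close> that saturation asks of the second
      coordinate.\<close>
    have u1: "u1 = p * d + (v1 + c * d)" using that(3) by (simp add: uv algebra_simps)
    have "v1 + c * d \<in> fst ` S" using shift_in[of v1 v2 c 0] that(2) uv by force
    moreover have "d dvd (v1 + c * d) + u2"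
    proof -
      have "d dvd p * d + ((v1 + c * d) + u2)" using dvd_sum[of u1 u2] that(1) by (simp add: uv u1 add.assoc)
      then show ?thesis by (simp add: dvd_add_right_iff)
    qed
    ultimately have "(v1 + c * d, u2 + c * d) \<in> S" by (rule saturated)
    then show ?thesis by (rule rev_image_eqI) (simp add: uv u1)
  qed
  \<comment> \<open>Degree at least \<open>2 * (q + c)\<close> forces one coordinate to be at least
    \<open>(q + c) * d\<close>. Removing the q-th power of the corresponding parameter leaves
    \<open>c * d\<close>, enough for saturation.\<close>
  show "\<exists>n. \<forall>u\<in>S. real n \<le> curve_deg d u \<longrightarrow> u \<in> (+) (0, q * d) ` S \<union> (+) (q * d, 0) ` S" for q
  proof (intro exI[of _ "2 * (q + c)"] ballI impI)
    fix u assume u: "u \<in> S" "real (2 * (q + c)) \<le> curve_deg d u"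
    obtain u1 u2 where u12: "u = (u1, u2)" by (cases u)
    have "real (2 * (q + c)) * real d \<le> real (u1 + u2)"
      using u(2) d_pos unfolding curve_deg_def u12 fst_conv snd_conv by (subst (asm) pos_le_divide_eq) simp_all
    then have "2 * (q + c) * d \<le> u1 + u2" by (simp only: of_nat_le_iff flip: of_nat_mult)
    then have "(q + c) * d \<le> u2 \<or> (q + c) * d \<le> u1" by linarith
    then show "u \<in> (+) (0, q * d) ` S \<union> (+) (q * d, 0) ` S"
    proof
      assume le: "(q + c) * d \<le> u2"
      define v where "v = u2 - (q + c) * d"
      have u2: "u2 = q * d + (v + c * d)" using le by (simp add: v_def algebra_simps)
      have "d dvd (q + c) * d + (u1 + v)" using dvd_sum[of u1 u2] u(1) by (simp add: u12 u2 algebra_simps)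
      then have "d dvd u1 + v" by (simp add: dvd_add_right_iff)
      then have "(u1, v + c * d) \<in> S" using u(1) u12 by (intro saturated(1)) force
      moreover have "u = (0, q * d) + (u1, v + c * d)" by (simp add: u12 u2)
      ultimately show ?thesis by blast
    next
      assume le: "(q + c) * d \<le> u1"
      define v where "v = u1 - (q + c) * d"
      have u1: "u1 = q * d + (v + c * d)" using le by (simp add: v_def algebra_simps)
      have "d dvd (q + c) * d + (v + u2)" using dvd_sum[of u1 u2] u(1) by (simp add: u12 u1 algebra_simps)
      then have "d dvd v + u2" by (simp add: dvd_add_right_iff)
      then have "(v + c * d, u2) \<in> S" using u(1) u12 by (intro saturated(2)) force
      moreover have "u = (q * d, 0) + (v + c * d, u2)" by (simp add: u12 u1)
      ultimately show ?thesis by blast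
    qed
  qed
  show "(0, n * d) \<in> S" "(n * d, 0) \<in> S" for n by (fact multiples_in)+
qed (use d_pos add_in in \<open>auto simp: curve_deg_def algebra_simps add_divide_distrib\<close>)

section \<open>Vanishing and surviving monomials\<close>

text \<open>The point obtained by lowering both coordinates by \<open>p * d\<close> lies in R_x if
  its first coordinate is at least \<open>\<alpha>\<close>, and in R_y if its second is at least
  \<open>\<beta>\<close>. The degree bound excludes that both inequalities fail.\<close>

lemma fraction_of_high_degree:
  assumes u: "(u1, u2) \<in> S" and \<alpha>: "\<alpha> \<in> fst ` S" "[\<alpha> = u1] (mod d)" and \<beta>: "\<beta> \<in> snd ` S" "[\<beta> = u2] (mod d)"
    and le: "\<alpha> + \<beta> + 2 * p * d \<le> u1 + u2 + d"
  shows "(0, c * d) + (c * d, 0) + (u1, u2) \<in> (+) ((p + c) * d, 0) ` S \<union> (+) (0, (p + c) * d) ` S"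
proof -
  have cong: "[\<alpha> + p * d = u1] (mod d)" "[\<beta> + p * d = u2] (mod d)"
    using \<alpha>(2) \<beta>(2) by (simp_all add: cong_def)
  have "\<alpha> + p * d \<le> u1 \<or> \<beta> + p * d \<le> u2"
  proof (rule ccontr)
    have step: "m + d \<le> n" if nm: "[n = m] (mod d)" "m < n" for m n
    proof -
      obtain i where i: "n = m + i * d"
        by (rule cong_le_multiple[OF cong_sym[OF nm(1)] less_imp_le[OF nm(2)]])
      with \<open>m < n\<close> have "i > 0" by (cases i) auto
      then show ?thesis using i by (cases i) auto
    qed
    assume "\<not> (\<alpha> + p * d \<le> u1 \<or> \<beta> + p * d \<le> u2)"
    \<comment> \<open>By the congruences, a coordinate below its threshold is below it by at least
      \<open>d\<close>. Two such deficits exceed the single \<open>d\<close> of slack in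
      \<open>le\<close>.\<close>
    then have "u1 + d \<le> \<alpha> + p * d" "u2 + d \<le> \<beta> + p * d"
      using step[OF cong(1)] step[OF cong(2)] by auto
    then show False using le d_pos by simp
  qed
  then show ?thesis
  proof
    assume "\<alpha> + p * d \<le> u1"
    then obtain i where i: "u1 = \<alpha> + p * d + i * d" by (rule cong_le_multiple[OF cong(1)])
    obtain v where "(\<alpha>, v) \<in> S" using \<alpha>(1) by auto
    then have "\<alpha> + i * d \<in> fst ` S" using shift_in[of \<alpha> v i 0] by force
    moreover have "d dvd p * d + (\<alpha> + i * d + u2)" using dvd_sum[OF u] by (simp add: i algebra_simps)
    then have "d dvd \<alpha> + i * d + u2" by (simp add: dvd_add_right_iff)
    ultimately have "(\<alpha> + i * d, u2 + c * d) \<in> S" by (rule saturated)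
    moreover have "(0, c * d) + (c * d, 0) + (u1, u2) = ((p + c) * d, 0) + (\<alpha> + i * d, u2 + c * d)"
      by (simp add: i algebra_simps)
    ultimately show ?thesis by blast
  next
    assume "\<beta> + p * d \<le> u2"
    then obtain i where i: "u2 = \<beta> + p * d + i * d" by (rule cong_le_multiple[OF cong(2)])
    obtain v where "(v, \<beta>) \<in> S" using \<beta>(1) by auto
    then have "\<beta> + i * d \<in> snd ` S" using shift_in[of v \<beta> 0 i] by force
    moreover have "d dvd p * d + (u1 + (\<beta> + i * d))" using dvd_sum[OF u] by (simp add: i algebra_simps)
    then have "d dvd u1 + (\<beta> + i * d)" by (simp add: dvd_add_right_iff)
    ultimately have "(u1 + c * d, \<beta> + i * d) \<in> S" by (rule saturated)
    moreover have "(0, c * d) + (c * d, 0) + (u1, u2) = (0, (p + c) * d) + (u1 + c * d, \<beta> + i * d)"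
      by (simp add: i algebra_simps)
    ultimately show ?thesis by blast
  qed
qed

text \<open>With denominator exponent \<open>Suc c\<close> the numerator represents the monomial
  with coordinates \<open>\<alpha>\<close> - d and \<open>\<beta>\<close> - d; the summand
  \<open>c * d\<close> only serves to place it in \<open>S\<close>. Membership in either shifted
  copy of \<open>S\<close> would put \<open>\<alpha>\<close> - d or \<open>\<beta>\<close> - d into
  a projection, against minimality.\<close>

lemma minimal_fraction:
  assumes \<alpha>: "\<alpha> \<in> fst ` S" "\<And>u. u \<in> fst ` S \<Longrightarrow> [u = \<alpha>] (mod d) \<Longrightarrow> \<alpha> \<le> u"
    and \<beta>: "\<And>v. v \<in> snd ` S \<Longrightarrow> [v = \<beta>] (mod d) \<Longrightarrow> \<beta> \<le> v"
    and dvd: "d dvd \<alpha> + \<beta>"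
  shows "(\<alpha> + c * d, \<beta> + c * d) \<in> S"
    "(0, q * d) + (q * d, 0) + (\<alpha> + c * d, \<beta> + c * d) \<notin>
      (+) ((Suc c + q) * d, 0) ` S \<union> (+) (0, (Suc c + q) * d) ` S"
proof -
  show "(\<alpha> + c * d, \<beta> + c * d) \<in> S"
    using shift_in[OF saturated(1)[OF \<alpha>(1) dvd], of c 0] by simp
  show "(0, q * d) + (q * d, 0) + (\<alpha> + c * d, \<beta> + c * d) \<notin>
      (+) ((Suc c + q) * d, 0) ` S \<union> (+) (0, (Suc c + q) * d) ` S"
  proof
    assume "(0, q * d) + (q * d, 0) + (\<alpha> + c * d, \<beta> + c * d) \<in>
      (+) ((Suc c + q) * d, 0) ` S \<union> (+) (0, (Suc c + q) * d) ` S"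
    then obtain s1 s2 where s: "(s1, s2) \<in> S" "\<alpha> = s1 + d \<or> \<beta> = s2 + d"
      by (auto simp: algebra_simps)
    have "s1 \<in> fst ` S" "s2 \<in> snd ` S" using s(1) by force+
    then show False
      using s(2) \<alpha>(2)[of s1] \<beta>[of s2] d_pos by (auto simp: cong_def)
  qed
qed

end

section \<open>Apery elements and the monoid of the curve\<close>

text \<open>At \<open>j = d\<close> the conventional value 0 is also the least element of its
  residue class, so the minimality property includes this endpoint. Otherwise \<open>s\<close>
  witnesses that the minimum exists.\<close>

lemma apery_minimal:
  assumes "j \<le> d" "s \<in> submonoid_generated A" "[s = j] (mod d)"
  shows "apery A d j \<in> submonoid_generated A" "[apery A d j = j] (mod d)" "apery A d j \<le> s"
proof -
  have "apery A d j \<in> submonoid_generated A \<and> [apery A d j = j] (mod d) \<and> apery A d j \<le> s"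
  proof (cases "j = d")
    case True
    then show ?thesis by (simp add: apery_def submonoid_generated.zero cong_def)
  next
    case False
    let ?P = "\<lambda>\<alpha>. \<alpha> \<in> submonoid_generated A \<and> [\<alpha> = j] (mod d)"
    have "?P s" using assms by blast
    then show ?thesis
      using LeastI[of ?P s] Least_le[of ?P s] False by (simp add: apery_def)
  qed
  then show "apery A d j \<in> submonoid_generated A" "[apery A d j = j] (mod d)" "apery A d j \<le> s"
    by blast+
qed

lemma curve_monoid_projections:
  shows fst_curve_monoid: "fst ` curve_monoid a k = submonoid_generated (A1 a k)"
    and snd_curve_monoid: "snd ` curve_monoid a k = submonoid_generated (A2 a k)"
proof -
  let ?G = "{(a i, a k - a i) |i. i \<le> k}"
  have 1: "fst s \<in> submonoid_generated (A1 a k) \<and> snd s \<in> submonoid_generated (A2 a k)"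
    if "s \<in> submonoid_generated ?G" for s
    using that
    by induction (auto simp: A1_def A2_def intro!: submonoid_generated.intros)
  have 2: "u \<in> fst ` submonoid_generated ?G" if "u \<in> submonoid_generated (A1 a k)" for u
    using that
  proof induction
    case zero
    show ?case using submonoid_generated.zero[of ?G] by (force simp: zero_prod_def)
  next
    case (add u v)
    then obtain i w where "u = a i" "i \<le> k" "(v, w) \<in> submonoid_generated ?G" by (auto simp: A1_def)
    then have "(a i, a k - a i) + (v, w) \<in> submonoid_generated ?G" by (intro submonoid_generated.add) auto
    then show ?case using \<open>u = a i\<close> by (force simp: image_iff)
  qed
  have 3: "u \<in> snd ` submonoid_generated ?G" if "u \<in> submonoid_generated (A2 a k)" for u
    using that
  proof induction
    case zero
    show ?case using submonoid_generated.zero[of ?G] by (force simp: zero_prod_def)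
  next
    case (add u v)
    then obtain i w where "u = a k - a i" "i \<le> k" "(w, v) \<in> submonoid_generated ?G" by (auto simp: A2_def)
    then have "(a i, a k - a i) + (w, v) \<in> submonoid_generated ?G" by (intro submonoid_generated.add) auto
    then show ?case using \<open>u = a k - a i\<close> by (force simp: image_iff)
  qed
  show "fst ` curve_monoid a k = submonoid_generated (A1 a k)"
    "snd ` curve_monoid a k = submonoid_generated (A2 a k)"
    unfolding curve_monoid_def using 1 2 3 by blast+
qed

lemma curve_cone_curve_monoid:
  assumes "a 0 = 0" "\<And>i. i \<le> k \<Longrightarrow> a i \<le> a k" "a k > 0" "Gcd (a ` {1..k}) = 1"
  shows "curve_cone (curve_monoid a k) (a k)"
proof
  show "(0, 0) \<in> curve_monoid a k"
    unfolding curve_monoid_def zero_prod_def[symmetric] by (rule submonoid_generated.zero)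
  show "s + t \<in> curve_monoid a k" if "s \<in> curve_monoid a k" "t \<in> curve_monoid a k" for s t
    using that by (simp add: curve_monoid_def submonoid_generated_plus)
  show "(0, a k) \<in> curve_monoid a k" "(a k, 0) \<in> curve_monoid a k"
    unfolding curve_monoid_def using assms(1) by (auto intro!: submonoid_generated_incl)
  show "0 < a k" by fact
  show "a k dvd u + v" if "(u, v) \<in> curve_monoid a k" for u v
  proof -
    have "a k dvd fst s + snd s" if "s \<in> submonoid_generated {(a i, a k - a i) |i. i \<le> k}" for s
      using that
    proof induction
      case (add s t)
      then obtain i where i: "s = (a i, a k - a i)" "i \<le> k" by blast
      have "fst (s + t) + snd (s + t) = a k + (fst t + snd t)"
        using assms(2)[OF i(2)] by (simp add: i(1))
      then show ?case using add.IH by (simp only: dvd_add_triv_left_iff)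
    qed simp
    from this[of "(u, v)"] that show ?thesis by (simp add: curve_monoid_def)
  qed
  show "\<exists>u \<in> fst ` curve_monoid a k. [u = j] (mod a k)" for j
  proof -
    \<comment> \<open>The gcd condition yields an element congruent to 1, whose j-fold multiple has
      residue \<open>j\<close>.\<close>
    obtain s where s: "s \<in> submonoid_generated (a ` {1..k})" "[s = 1] (mod a k)"
      using submonoid_generated_Gcd_cong[of "a ` {1..k}" "a k"] assms(3,4) by auto
    have "s \<in> submonoid_generated (A1 a k)"
      using s(1) by (rule submonoid_generated_mono) (auto simp: A1_def)
    then have "j * s \<in> fst ` curve_monoid a k"
      by (simp add: fst_curve_monoid submonoid_generated_times)
    moreover have "[j * s = j * 1] (mod a k)" by (intro cong_mult cong_refl s(2))
    ultimately show ?thesis by (intro bexI[of _ "j * s"]) simp_all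
  qed
qed

section \<open>The largest degree with nonzero second cohomology\<close>

theorem lemma4p1:
  fixes a :: "nat \<Rightarrow> nat" and k d :: nat
    and R :: "(nat \<times> nat \<Rightarrow>\<^sub>0 'k::field) graded_ring"
    and \<mm> :: "(nat \<times> nat \<Rightarrow>\<^sub>0 'k) set"
    and \<epsilon> :: "(nat \<times> nat \<Rightarrow>\<^sub>0 'k) \<Rightarrow> 'm"
    and I :: "nat \<Rightarrow> (nat \<times> nat \<Rightarrow>\<^sub>0 'k, 'm) graded_module"
    and \<delta> :: "nat \<Rightarrow> 'm \<Rightarrow> 'm"
  assumes "k \<ge> 3"
    and "a 0 = 0"
    and "\<And>i. i < k \<Longrightarrow> a i < a (Suc i)"
    and "d = a k"
    and "Gcd (a ` {1..k}) = 1"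
    and "k < d"
    and "R = semigroup_ring (curve_deg d) (curve_monoid a k)"
    and "\<mm> = semigroup_ring_max_ideal (curve_monoid a k)"
    and "graded_injective_resolution R (regular_module R) \<epsilon> I \<delta>"
  shows "a_invariant R \<mm> I \<delta> 2 =
           ereal (Max ((\<lambda>i. curve_deg d (apery_pair a k i)) ` {0..d - 1}) - 2) \<and>
         Max ((\<lambda>i. curve_deg d (apery_pair a k i)) ` {0..d - 1}) - 2 =
           Max ((\<lambda>i. real (apery (A1 a k) d i + apery (A2 a k) d (d - i)) / real d) ` {0..d - 1}) - 2"
proof
  let ?S = "curve_monoid a k"
  define \<alpha> where "\<alpha> j = apery (A1 a k) d j" for j
  \<comment> \<open>For \<open>j\<close> = 0 the argument is \<open>d\<close>, where
    \<open>apery\<close> takes the conventional value 0.\<close>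
  define \<beta> where "\<beta> j = apery (A2 a k) d (d - j)" for j
  have pair: "apery_pair a k j = (\<alpha> j, \<beta> j)" for j
    by (simp add: apery_pair_def \<alpha>_def \<beta>_def assms(4))
  show "Max ((\<lambda>i. curve_deg d (apery_pair a k i)) ` {0..d - 1}) - 2 =
      Max ((\<lambda>i. real (apery (A1 a k) d i + apery (A2 a k) d (d - i)) / real d) ` {0..d - 1}) - 2"
    by (simp add: pair curve_deg_def \<alpha>_def \<beta>_def)
  have "a i \<le> a j" if "i \<le> j" "j \<le> k" for i j
    using that(1,2)
  proof (induction j rule: dec_induct)
    case (step n)
    then show ?case using assms(3)[of n] by simp
  qed simp
  then have "curve_cone ?S d"
    unfolding assms(4) using assms(2,4-6) by (intro curve_cone_curve_monoid) auto
  then obtain c where "saturated_curve_cone ?S d c"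
    using curve_cone.saturated_curve_cone by blast
  then interpret saturated_curve_cone ?S d c .
  interpret swap: curve_cone "prod.swap ` ?S" d by (rule curve_cone_swap)
  let ?X = "\<lambda>n. (0, n * d)" and ?Y = "\<lambda>n. (n * d, 0)"
  interpret resolved_two_parameters ?S "curve_deg d" R ?X ?Y c \<epsilon> I \<delta>
    using two_parameters[OF assms(7)] assms(9)
    by (intro resolved_two_parameters.intro resolved_two_parameters_axioms.intro)
  have \<alpha>: "\<alpha> j \<in> fst ` ?S" "[\<alpha> j = j] (mod d)" "\<And>u. u \<in> fst ` ?S \<Longrightarrow> [u = j] (mod d) \<Longrightarrow> \<alpha> j \<le> u"
    if "j \<le> d" for j
    unfolding \<alpha>_def using apery_minimal[OF that, where A = "A1 a k"] residue[of j] by (auto simp: fst_curve_monoid)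
  have \<beta>: "\<beta> j \<in> snd ` ?S" "[\<beta> j = d - j] (mod d)" "\<And>u. u \<in> snd ` ?S \<Longrightarrow> [u = d - j] (mod d) \<Longrightarrow> \<beta> j \<le> u"
    if "j \<le> d" for j
    unfolding \<beta>_def using apery_minimal[of "d - j" d, where A = "A2 a k"] swap.residue[of "d - j"]
    by (auto simp: image_image simp flip: snd_curve_monoid)
  have dvd: "d dvd \<alpha> j + \<beta> j" if "j \<le> d" for j
  proof -
    have "[\<alpha> j + \<beta> j = j + (d - j)] (mod d)" using \<alpha>(2) \<beta>(2) that by (intro cong_add)
    then show ?thesis using that by (simp add: cong_def mod_eq_0_iff_dvd)
  qed
  define M where "M = Max ((\<lambda>i. curve_deg d (apery_pair a k i)) ` {0..d - 1})"
  have "M \<in> (\<lambda>i. curve_deg d (apery_pair a k i)) ` {0..d - 1}"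
    unfolding M_def by (intro Max_in) auto
  then obtain j where "j \<in> {0..d - 1}" "M = curve_deg d (\<alpha> j, \<beta> j)" by (auto simp: pair)
  then have j: "j \<le> d" "real (\<alpha> j + \<beta> j) = M * real d" using d_pos by (auto simp: curve_deg_def)
  \<comment> \<open>The maximal degree is an integer \<open>e\<close>, because \<open>d\<close>
    divides the coordinate sum of each pair.\<close>
  obtain e where "\<alpha> j + \<beta> j = d * e" using dvd[OF j(1)] by (auto elim: dvdE)
  then have M: "M = real e" using j(2) d_pos by simp
  have M_ge: "\<alpha> i + \<beta> i \<le> e * d" if "i < d" for i
  proof -
    have "curve_deg d (\<alpha> i, \<beta> i) \<le> M"
      unfolding M_def pair using that by (intro Max_ge) auto
    then have "real (\<alpha> i + \<beta> i) \<le> real (e * d)" using d_pos by (simp add: M curve_deg_def field_simps)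
    then show ?thesis by (simp only: of_nat_le_iff)
  qed
  have "a_invariant R (semigroup_ring_max_ideal ?S) I \<delta> 2 = ereal (of_int (int e - 2))"
  proof (rule a_invariant_eqI)
    fix n p u assume n: "int e - 2 < n" and u: "u \<in> ?S" "curve_deg d u = of_int n + 2 * real p"
    obtain u1 u2 where u12: "u = (u1, u2)" by (cases u)
    have "real_of_int (int (u1 + u2)) = real_of_int ((n + 2 * int p) * int d)"
      using u(2) d_pos by (simp add: u12 curve_deg_def field_simps)
    then have sum: "int (u1 + u2) = (n + 2 * int p) * int d" by (simp only: of_int_eq_iff)
    let ?i = "u1 mod d"
    have i: "?i < d" using d_pos by simp
    have cong1: "[\<alpha> ?i = u1] (mod d)" using \<alpha>(2)[of ?i] i by (simp add: cong_def)
    \<comment> \<open>Both coordinate sums are divisible by \<open>d\<close>, so agreement of the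
      first coordinates modulo \<open>d\<close> forces agreement of the second.\<close>
    have "[\<alpha> ?i + \<beta> ?i = u1 + u2] (mod d)"
      using dvd[of ?i] dvd_sum[of u1 u2] u(1) i by (simp add: u12 cong_def mod_eq_0_iff_dvd)
    then have "[u1 + \<beta> ?i = u1 + u2] (mod d)"
      using cong_trans[OF cong_add[OF cong_sym[OF cong1] cong_refl]] by blast
    then have cong2: "[\<beta> ?i = u2] (mod d)" by (simp add: cong_add_lcancel_nat)
    have "int (\<alpha> ?i + \<beta> ?i + 2 * p * d) \<le> int (e * d + 2 * p * d)"
      unfolding of_nat_le_iff using M_ge[OF i] by simp
    also have "\<dots> = int e * int d + 2 * int p * int d" by simp
    \<comment> \<open>A degree above \<open>e - 2\<close> satisfies e <= n + 1; the extra 1 gives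
      the slack \<open>d\<close> allowed in \<open>fraction_of_high_degree\<close>.\<close>
    also have "\<dots> \<le> (n + 1) * int d + 2 * int p * int d"
      using n by (intro add_right_mono mult_right_mono) auto
    also have "\<dots> = int (u1 + u2 + d)" using sum by (simp add: algebra_simps)
    finally have "\<alpha> ?i + \<beta> ?i + 2 * p * d \<le> u1 + u2 + d" by (simp only: of_nat_le_iff)
    then show "\<exists>q. ?X q + ?Y q + u \<in> (+) (?Y (p + q)) ` ?S \<union> (+) (?X (p + q)) ` ?S"
      using fraction_of_high_degree[of u1 u2 "\<alpha> ?i" "\<beta> ?i" p] \<alpha>(1)[of ?i] \<beta>(1)[of ?i] cong1 cong2 u(1) i u12
      by auto
  next
    have min: "\<And>u. u \<in> fst ` ?S \<Longrightarrow> [u = \<alpha> j] (mod d) \<Longrightarrow> \<alpha> j \<le> u"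
      "\<And>u. u \<in> snd ` ?S \<Longrightarrow> [u = \<beta> j] (mod d) \<Longrightarrow> \<beta> j \<le> u"
      using \<alpha>(2,3)[OF j(1)] \<beta>(2,3)[OF j(1)] cong_trans by blast+
    note fraction = minimal_fraction[OF \<alpha>(1)[OF j(1)] min dvd[OF j(1)]]
    show "(\<alpha> j + c * d, \<beta> j + c * d) \<in> ?S" by (rule fraction(1))
    \<comment> \<open>The numerator has degree e + 2 c, and the denominator exponent
      \<open>Suc c\<close> turns this into degree \<open>e - 2\<close> of the fraction.\<close>
    show "curve_deg d (\<alpha> j + c * d, \<beta> j + c * d) = of_int (int e - 2) + 2 * real (Suc c)"
      using j(2) d_pos by (simp add: M curve_deg_def field_simps)
    show "?X q + ?Y q + (\<alpha> j + c * d, \<beta> j + c * d) \<notin> (+) (?Y (Suc c + q)) ` ?S \<union> (+) (?X (Suc c + q)) ` ?S" for q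
      by (rule fraction(2))
  qed
  then show "a_invariant R \<mm> I \<delta> 2 = ereal (Max ((\<lambda>i. curve_deg d (apery_pair a k i)) ` {0..d - 1}) - 2)"
    unfolding assms(8) M_def[symmetric] M by simp
qed

end
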